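(* There is a constant $c>0$ depending only on $n$ and $d$ such that the following holds. Let $W:\mathbb{R}^d\to\mathcal{M}_n(\mathbb{C})$ be a matrix $A_2$ weight, let $\mathscr{D}$ be a dyadic grid in $\mathbb{R}^d$, and let $\{A_I^\varepsilon\}_{I\in\mathscr{D},\varepsilon\in\mathrm{Sig}_d}$ be any sequence of $n\times n$ complex matrices for which there is $C>0$, independent of $J$, with $$\sum_{\varepsilon\in\mathrm{Sig}_d}\sum_{I\in\mathscr{D}(J)}(A_I^\varepsilon)^*A_I^\varepsilon<C\int_JW(x)\,dx\qquad\text{for all }J\in\mathscr{D}.$$ Then for all $\vec f\in L^2(W)$ $$\sum_{\varepsilon\in\mathrm{Sig}_d}\sum_{I\in\mathscr{D}}|A_I^\varepsilon(m_I\vec f)|^2\le c\,C\,\|W\|_{A_2}^3\,\|\vec f\|_{L^2(W)}^2.$$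
   Context: $n,d\ge 1$ are integers; $\mathcal{M}_n(\mathbb{C})$ is the algebra of $n\times n$ complex matrices with operator norm $\|\cdot\|$; matrix inequalities are in the sense of Hermitian quadratic forms; $|\cdot|$ is the Euclidean norm on $\mathbb{C}^n$; cubes have sides parallel to the axes; $m_I\vec f$ is the componentwise average of $\vec f$ over $I$. For measurable a.e. positive definite $W:\mathbb{R}^d\to\mathcal{M}_n(\mathbb{C})$, $\|\vec f\|_{L^2(W)}^2=\int_{\mathbb{R}^d}|W^{1/2}\vec f|^2\,dx$. $W$ is a matrix $A_2$ weight if $$\|W\|_{A_2}:=\sup_{I\text{ cube}}\frac1{|I|}\int_I\frac1{|I|}\int_I\|W^{1/2}(x)W^{-1/2}(t)\|^{2}\,dt\,dx<\infty.$$ A dyadic grid is a nested family of half-open cubes of side lengths $2^k$, $k\in\mathbb{Z}$, such that for each $k$ the cubes of side length $2^k$ partition $\mathbb{R}^d$. $\mathscr{D}(J)=\{I\in\mathscr{D}:I\subseteq J\}$; $\mathrm{Sig}_d=\{0,1\}^d\setminus\{(1,\dots,1)\}$. *)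

theory Defs
  imports "HOL-Analysis.Analysis"
begin

section \<open>Complex matrices\<close>

definition cinner :: "complex ^ 'n \<Rightarrow> complex ^ 'n \<Rightarrow> complex" where
  "cinner x y = (\<Sum>i\<in>UNIV. x $ i * cnj (y $ i))"

definition conj_transpose :: "complex ^ 'n ^ 'm \<Rightarrow> complex ^ 'm ^ 'n" where
  "conj_transpose A = (\<chi> i j. cnj (A $ j $ i))"

definition hermitian :: "complex ^ 'n ^ 'n \<Rightarrow> bool" where
  "hermitian A \<longleftrightarrow> conj_transpose A = A"

definition pos_semidef :: "complex ^ 'n ^ 'n \<Rightarrow> bool" where
  "pos_semidef A \<longleftrightarrow> hermitian A \<and> (\<forall>x. 0 \<le> Re (cinner (A *v x) x))"

definition pos_def :: "complex ^ 'n ^ 'n \<Rightarrow> bool" where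
  "pos_def A \<longleftrightarrow> hermitian A \<and> (\<forall>x. x \<noteq> 0 \<longrightarrow> 0 < Re (cinner (A *v x) x))"

text \<open>The strict inequality of Hermitian quadratic forms. It is not the strict part of the
  ordering given by \<open>pos_semidef (B - A)\<close>.\<close>

definition loewner_less :: "complex ^ 'n ^ 'n \<Rightarrow> complex ^ 'n ^ 'n \<Rightarrow> bool" where
  "loewner_less A B \<longleftrightarrow> pos_def (B - A)"

text \<open>The positive square root. The value is unspecified if \<open>A\<close> is not positive
  semidefinite.\<close>

definition mat_sqrt :: "complex ^ 'n ^ 'n \<Rightarrow> complex ^ 'n ^ 'n" where
  "mat_sqrt A = (THE B. pos_semidef B \<and> B ** B = A)"

definition op_norm :: "complex ^ 'n ^ 'm \<Rightarrow> real" where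
  "op_norm A = onorm (\<lambda>x. A *v x)"


section \<open>Cubes and dyadic grids\<close>

definition cube :: "real ^ 'd \<Rightarrow> real \<Rightarrow> (real ^ 'd) set" where
  "cube a l = {x. \<forall>i. a $ i \<le> x $ i \<and> x $ i \<le> a $ i + l}"

definition half_open_cube :: "real ^ 'd \<Rightarrow> real \<Rightarrow> (real ^ 'd) set" where
  "half_open_cube a l = {x. \<forall>i. a $ i \<le> x $ i \<and> x $ i < a $ i + l}"

definition dyadic_grid :: "(real ^ 'd) set set \<Rightarrow> bool" where
  "dyadic_grid D \<longleftrightarrow>
     (\<forall>I\<in>D. \<exists>a (k::int). I = half_open_cube a (2 powi k)) \<and>
     (\<forall>I\<in>D. \<forall>J\<in>D. I \<subseteq> J \<or> J \<subseteq> I \<or> I \<inter> J = {}) \<and>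
     (\<forall>k::int. partition_on UNIV {I \<in> D. \<exists>a. I = half_open_cube a (2 powi k)})"

definition subcubes :: "(real ^ 'd) set set \<Rightarrow> (real ^ 'd) set \<Rightarrow> (real ^ 'd) set set" where
  "subcubes D J = {I \<in> D. I \<subseteq> J}"

definition Sig :: "(nat ^ 'd) set" where
  "Sig = {e. \<forall>i. e $ i \<in> {0, 1}} - {\<chi> i. 1}"

definition avg :: "(real ^ 'd) set \<Rightarrow> (real ^ 'd \<Rightarrow> complex ^ 'n) \<Rightarrow> complex ^ 'n" where
  "avg I f = (1 / measure lebesgue I) *\<^sub>R (LINT x:I|lebesgue. f x)"


section \<open>Matrix weights\<close>

text \<open>Characteristics and norms are extended nonnegative reals, so that an infinite value is
  not mistaken for \<open>0\<close>.\<close>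

definition A2_char :: "(real ^ 'd \<Rightarrow> complex ^ 'n ^ 'n) \<Rightarrow> ennreal" where
  "A2_char W =
     (SUP I \<in> {cube a l | a l. l > 0}.
        (\<integral>\<^sup>+x\<in>I.
           (\<integral>\<^sup>+t\<in>I. ennreal ((op_norm (mat_sqrt (W x) ** matrix_inv (mat_sqrt (W t))))\<^sup>2)
              \<partial>lebesgue) / emeasure lebesgue I
           \<partial>lebesgue) / emeasure lebesgue I)"

definition A2_weight :: "(real ^ 'd \<Rightarrow> complex ^ 'n ^ 'n) \<Rightarrow> bool" where
  "A2_weight W \<longleftrightarrow>
     W \<in> borel_measurable lebesgue \<and> (AE x in lebesgue. pos_def (W x)) \<and> A2_char W < \<infinity>"

definition L2W_norm_sq ::
  "(real ^ 'd \<Rightarrow> complex ^ 'n ^ 'n) \<Rightarrow> (real ^ 'd \<Rightarrow> complex ^ 'n) \<Rightarrow> ennreal" where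
  "L2W_norm_sq W f = (\<integral>\<^sup>+x. ennreal ((norm (mat_sqrt (W x) *v f x))\<^sup>2) \<partial>lebesgue)"

definition L2W ::
  "(real ^ 'd \<Rightarrow> complex ^ 'n ^ 'n) \<Rightarrow> (real ^ 'd \<Rightarrow> complex ^ 'n) set" where
  "L2W W = {f. f \<in> borel_measurable lebesgue \<and> L2W_norm_sq W f < \<infinity>}"

text \<open>The packing condition with constant \<open>C\<close>. Convergence of the series of matrices is part of
  the condition, since \<open>infsum\<close> is \<open>0\<close> on families that are not summable.\<close>

definition matrix_carleson ::
  "(real ^ 'd \<Rightarrow> complex ^ 'n ^ 'n) \<Rightarrow> (real ^ 'd) set set \<Rightarrow>
   ((real ^ 'd) set \<Rightarrow> nat ^ 'd \<Rightarrow> complex ^ 'n ^ 'n) \<Rightarrow> real \<Rightarrow> bool" where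
  "matrix_carleson W D A C \<longleftrightarrow>
     (\<forall>J\<in>D.
        (\<forall>\<epsilon>\<in>Sig. (\<lambda>I. conj_transpose (A I \<epsilon>) ** A I \<epsilon>) summable_on subcubes D J) \<and>
        loewner_less
          (\<Sum>\<epsilon>\<in>Sig. \<Sum>\<^sub>\<infinity>I\<in>subcubes D J. conj_transpose (A I \<epsilon>) ** A I \<epsilon>)
          (C *\<^sub>R (LINT x:J|lebesgue. W x)))"

end

theory Submission
  imports Defs
begin

text \<open>The proof is a Bellman function argument. Write \<open>V = W\<^sup>-\<^sup>1\<close>, let \<open>W\<^sub>J\<close>, \<open>V\<^sub>J\<close>, \<open>f\<^sub>J\<close> be the
averages over a cube \<open>J\<close>, let \<open>\<bullet>\<close> be the real part of the trace inner product of matrices, and put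
\<open>\<kappa> = n \<parallel>W\<parallel>\<close>, with \<open>\<parallel>W\<parallel>\<close> the \<open>A\<^sub>2\<close> characteristic. The weight enters through two facts:
\<open>V\<^sub>J\<^sup>-\<^sup>1 \<le> W\<^sub>J\<close>, which is Cauchy-Schwarz, and \<open>W\<^sub>J \<bullet> V\<^sub>J \<le> \<kappa>\<close>, which is the \<open>A\<^sub>2\<close> condition because
the squared Frobenius norm of a matrix is at most \<open>n\<close> times its squared operator norm. The second one
gives \<open>V\<^sub>J \<le> \<kappa> W\<^sub>J\<^sup>-\<^sup>1\<close> and \<open>W\<^sub>J \<le> \<kappa> V\<^sub>J\<^sup>-\<^sup>1\<close>.

It suffices to attach to every cube \<open>J\<close> of the grid a number \<open>B\<^sub>J\<close> between \<open>0\<close> and the average of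
\<open>|W\<^sup>1\<^sup>/\<^sup>2 f|\<^sup>2\<close> over \<open>J\<close> that exceeds the average of \<open>B\<close> over the dyadic children of \<open>J\<close> by at least
\<open>(64 \<kappa>\<^sup>3 C |J|)\<^sup>-\<^sup>1\<close> times the sum of the \<open>|A\<^sub>J f\<^sub>J|\<^sup>2\<close>. Multiplying by \<open>|J|\<close> and telescoping over the
levels of the grid gives the theorem for finite sets of cubes (\<open>grid_telescoping\<close>,
\<open>finite_carleson_embedding\<close>), and the sum of a nonnegative family is the supremum of its finite sums.

The number \<open>B\<^sub>J\<close> is built in three layers, each from a convexity property of matrix functions. Let
\<open>N\<^sub>J\<close> be \<open>(C |J|)\<^sup>-\<^sup>1\<close> times the sum of the \<open>A\<^sub>I\<^sup>* A\<^sub>I\<close> over the cubes \<open>I\<close> below \<open>J\<close>, so that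
\<open>N\<^sub>J \<le> W\<^sub>J\<close>, and let \<open>P\<close> be the contribution of \<open>J\<close> itself.

\<^item> The logarithm of the determinant is concave. Hence the height
  \<open>h\<^sub>J = 1 + (ln det (W\<^sub>J + N\<^sub>J) + ln det V\<^sub>J) / (2 \<kappa>)\<close>, which lies between \<open>1\<close> and \<open>2\<close>, exceeds the
  average height of the children by at least \<open>W\<^sub>J\<^sup>-\<^sup>1 \<bullet> P / (4 \<kappa>)\<close> (\<open>height_gain\<close>). This turns the
  matrix packing condition into a packing condition for numbers.
\<^item> The function \<open>W\<^sup>-\<^sup>1 / h\<close> is convex in \<open>(W, h)\<close>. Hence \<open>X\<^sub>J = 2 V\<^sub>J - W\<^sub>J\<^sup>-\<^sup>1 / h\<^sub>J\<close>, which lies between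
  \<open>V\<^sub>J\<close> and \<open>2 V\<^sub>J\<close>, exceeds the average of its children by a quarter of the gain in height times
  \<open>W\<^sub>J\<^sup>-\<^sup>1\<close> (\<open>matrix_gain\<close>).
\<^item> The form \<open>\<langle>X\<^sup>-\<^sup>1 f, f\<rangle>\<close> is convex in \<open>(X, f)\<close>. The number \<open>B\<^sub>J\<close> is the average of
  \<open>|W\<^sup>1\<^sup>/\<^sup>2 f|\<^sup>2\<close> minus \<open>\<langle>X\<^sub>J\<^sup>-\<^sup>1 f\<^sub>J, f\<^sub>J\<rangle>\<close>, and the gain in \<open>X\<close> becomes the required gain in \<open>B\<close>
  (\<open>bellman_gain\<close>).

One power of \<open>\<kappa>\<close> normalizes the height, one is lost in replacing \<open>W\<^sub>J\<^sup>-\<^sup>1\<close> by \<open>V\<^sub>J\<close>, and one in replacing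
\<open>V\<^sub>J\<^sup>-\<^sup>1\<close> by \<open>W\<^sub>J\<close>.\<close>

section \<open>Adjoints, positive matrices and inverses\<close>

text \<open>The real part of the Hermitian inner product is the Euclidean inner product of the type. Quadratic
forms of Hermitian matrices are therefore written with \<open>\<bullet>\<close>, which makes the library of real inner
product spaces available.\<close>

lemma Re_cinner: "Re (cinner x y) = x \<bullet> y"
  by (simp add: cinner_def inner_vec_def inner_complex_def)

lemma inner_matrix_eq:
  fixes A B :: "complex ^ 'n ^ 'm"
  shows "A \<bullet> B = Re (\<Sum>i\<in>UNIV. \<Sum>j\<in>UNIV. A $ i $ j * cnj (B $ i $ j))"
  by (simp add: inner_vec_def inner_complex_def)

lemma conj_transpose_nth [simp]: "conj_transpose A $ i $ j = cnj (A $ j $ i)"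
  by (simp add: conj_transpose_def)

lemma conj_transpose_conj_transpose [simp]: "conj_transpose (conj_transpose A) = A"
  by (simp add: vec_eq_iff)

lemma conj_transpose_mult: "conj_transpose (A ** B) = conj_transpose B ** conj_transpose A"
  by (simp add: vec_eq_iff matrix_matrix_mult_def mult.commute)

lemma conj_transpose_mat_1 [simp]: "conj_transpose (mat 1) = mat 1"
  by (auto simp add: vec_eq_iff mat_def)

lemma conj_transpose_linear:
  "conj_transpose (A + B) = conj_transpose A + conj_transpose B"
  "conj_transpose (A - B) = conj_transpose A - conj_transpose B"
  "conj_transpose (r *\<^sub>R A) = r *\<^sub>R conj_transpose A"
  by (simp_all add: vec_eq_iff)

lemma bounded_linear_conj_transpose: "bounded_linear conj_transpose"
  by (intro linear_conv_bounded_linear[THEN iffD1] linearI) (simp_all add: conj_transpose_linear)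

lemma inner_matrix_vector:
  fixes A :: "complex ^ 'n ^ 'm"
  shows "(A *v x) \<bullet> y = x \<bullet> (conj_transpose A *v y)"
proof -
  have "(A *v x) \<bullet> y = Re (\<Sum>i\<in>UNIV. \<Sum>j\<in>UNIV. A $ i $ j * x $ j * cnj (y $ i))"
    by (simp add: Re_cinner[symmetric] cinner_def matrix_vector_mult_def sum_distrib_right)
  also have "\<dots> = Re (\<Sum>j\<in>UNIV. \<Sum>i\<in>UNIV. A $ i $ j * x $ j * cnj (y $ i))"
    by (subst sum.swap) simp
  also have "\<dots> = x \<bullet> (conj_transpose A *v y)"
    by (simp add: Re_cinner[symmetric] cinner_def matrix_vector_mult_def sum_distrib_left ac_simps del: Re_sum)
  finally show ?thesis .
qed

lemma linear_matrix_vector_left: "linear (\<lambda>A :: complex ^ 'n ^ 'm. A *v x)"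
  by (intro linearI) (simp_all add: matrix_vector_mult_def vec_eq_iff sum.distrib distrib_right scaleR_sum_right)

lemma linear_matrix_vector_right: "linear (\<lambda>x. (A :: complex ^ 'n ^ 'm) *v x)"
  by (intro linearI) (simp_all add: matrix_vector_mult_def vec_eq_iff sum.distrib distrib_left scaleR_sum_right)

lemmas matrix_vector_linear =
  linear_add[OF linear_matrix_vector_left] linear_diff[OF linear_matrix_vector_left]
  linear_scale[OF linear_matrix_vector_left] linear_0[OF linear_matrix_vector_left]
  linear_add[OF linear_matrix_vector_right] linear_diff[OF linear_matrix_vector_right]
  linear_scale[OF linear_matrix_vector_right] linear_0[OF linear_matrix_vector_right]

lemma linear_matrix_mult_left: "linear (\<lambda>A :: complex ^ 'n ^ 'm. A ** (B :: complex ^ 'k ^ 'n))"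
  by (intro linearI) (simp_all add: matrix_matrix_mult_def vec_eq_iff sum.distrib distrib_right scaleR_sum_right)

lemma linear_matrix_mult_right: "linear (\<lambda>B :: complex ^ 'k ^ 'n. (A :: complex ^ 'n ^ 'm) ** B)"
  by (intro linearI) (simp_all add: matrix_matrix_mult_def vec_eq_iff sum.distrib distrib_left scaleR_sum_right)

text \<open>On matrices \<open>\<bullet>\<close> is the real part of \<open>trace (A B\<^sup>*)\<close>, and the two adjoint rules for products
express that the trace is cyclic.\<close>

lemma inner_matrix_mult_left:
  fixes A :: "complex ^ 'n ^ 'm" and B :: "complex ^ 'k ^ 'n"
  shows "(A ** B) \<bullet> C = B \<bullet> (conj_transpose A ** C)"
proof -
  have "(A ** B) \<bullet> C = Re (\<Sum>i\<in>UNIV. \<Sum>j\<in>UNIV. \<Sum>k\<in>UNIV. A $ i $ k * B $ k $ j * cnj (C $ i $ j))"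
    by (simp add: inner_matrix_eq matrix_matrix_mult_def sum_distrib_right del: Re_sum)
  also have "(\<Sum>i\<in>UNIV. \<Sum>j\<in>UNIV. \<Sum>k\<in>UNIV. A $ i $ k * B $ k $ j * cnj (C $ i $ j))
      = (\<Sum>i\<in>UNIV. \<Sum>k\<in>UNIV. \<Sum>j\<in>UNIV. A $ i $ k * B $ k $ j * cnj (C $ i $ j))"
    by (intro sum.cong refl sum.swap)
  also have "\<dots> = (\<Sum>k\<in>UNIV. \<Sum>i\<in>UNIV. \<Sum>j\<in>UNIV. A $ i $ k * B $ k $ j * cnj (C $ i $ j))"
    by (rule sum.swap)
  also have "\<dots> = (\<Sum>k\<in>UNIV. \<Sum>j\<in>UNIV. \<Sum>i\<in>UNIV. A $ i $ k * B $ k $ j * cnj (C $ i $ j))"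
    by (intro sum.cong refl sum.swap)
  also have "Re \<dots> = B \<bullet> (conj_transpose A ** C)"
    by (simp add: inner_matrix_eq matrix_matrix_mult_def sum_distrib_left ac_simps del: Re_sum)
  finally show ?thesis .
qed

lemma inner_conj_transpose: "conj_transpose A \<bullet> conj_transpose B = A \<bullet> B"
  unfolding inner_matrix_eq by (subst sum.swap) (simp add: mult.commute)

lemma inner_matrix_mult_right:
  fixes A :: "complex ^ 'n ^ 'm" and B :: "complex ^ 'k ^ 'n"
  shows "(A ** B) \<bullet> C = A \<bullet> (C ** conj_transpose B)"
proof -
  have "(A ** B) \<bullet> C = conj_transpose (A ** B) \<bullet> conj_transpose C"
    by (rule inner_conj_transpose[symmetric])
  also have "\<dots> = conj_transpose A \<bullet> conj_transpose (C ** conj_transpose B)"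
    by (simp add: conj_transpose_mult inner_matrix_mult_left)
  finally show ?thesis
    by (simp add: inner_conj_transpose)
qed

lemma matrix_vector_axis: "((A :: complex ^ 'n ^ 'm) *v axis j 1) $ i = A $ i $ j"
  by (simp add: matrix_vector_mult_def axis_def mult_delta_left mult_delta_right)

lemma inner_matrix_columns:
  fixes A B :: "complex ^ 'n ^ 'm"
  shows "A \<bullet> B = (\<Sum>j\<in>UNIV. (A *v axis j 1) \<bullet> (B *v axis j 1))"
proof -
  have "A \<bullet> B = (\<Sum>i\<in>UNIV. \<Sum>j\<in>UNIV. A $ i $ j \<bullet> B $ i $ j)"
    by (simp add: inner_vec_def)
  also have "\<dots> = (\<Sum>j\<in>UNIV. \<Sum>i\<in>UNIV. A $ i $ j \<bullet> B $ i $ j)"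
    by (rule sum.swap)
  finally show ?thesis
    by (simp add: inner_vec_def[where 'a=complex] matrix_vector_axis)
qed

lemma hermitianD: "hermitian A \<Longrightarrow> (A *v x) \<bullet> y = x \<bullet> (A *v y)"
  by (simp add: hermitian_def inner_matrix_vector)

lemma hermitian_intros:
  "hermitian A \<Longrightarrow> hermitian B \<Longrightarrow> hermitian (A + B)"
  "hermitian A \<Longrightarrow> hermitian B \<Longrightarrow> hermitian (A - B)"
  "hermitian A \<Longrightarrow> hermitian (r *\<^sub>R A)"
  "hermitian (mat 1)"
  "hermitian 0"
  by (simp_all add: hermitian_def conj_transpose_linear vec_eq_iff mat_def)

lemma pos_semidef_iff: "pos_semidef A \<longleftrightarrow> hermitian A \<and> (\<forall>x. 0 \<le> (A *v x) \<bullet> x)"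
  by (simp add: pos_semidef_def Re_cinner)

lemma pos_def_iff: "pos_def A \<longleftrightarrow> hermitian A \<and> (\<forall>x. x \<noteq> 0 \<longrightarrow> 0 < (A *v x) \<bullet> x)"
  by (simp add: pos_def_def Re_cinner)

lemma pos_def_imp_pos_semidef: "pos_def A \<Longrightarrow> pos_semidef A"
  unfolding pos_semidef_iff pos_def_iff
  by (metis inner_zero_right linorder_le_less_linear not_less_iff_gr_or_eq)

lemma pos_semidef_intros:
  "pos_semidef A \<Longrightarrow> pos_semidef B \<Longrightarrow> pos_semidef (A + B)"
  "pos_semidef A \<Longrightarrow> 0 \<le> r \<Longrightarrow> pos_semidef (r *\<^sub>R A)"
  "pos_semidef (mat 1)"
  "pos_semidef 0"
  unfolding pos_semidef_iff by (auto intro!: hermitian_intros simp: matrix_vector_linear inner_left_distrib)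

lemma pos_semidef_sum: "(\<And>i. i \<in> I \<Longrightarrow> pos_semidef (A i)) \<Longrightarrow> pos_semidef (\<Sum>i\<in>I. A i)"
  by (induction I rule: infinite_finite_induct) (auto intro: pos_semidef_intros)

lemma pos_semidef_gram: "pos_semidef (conj_transpose A ** A)"
  unfolding pos_semidef_iff hermitian_def
  by (simp add: conj_transpose_mult matrix_vector_mul_assoc[symmetric]
      inner_matrix_vector[of "conj_transpose A"])

lemma gram_quadratic_form: "((conj_transpose A ** A) *v x) \<bullet> x = (norm (A *v x))\<^sup>2"
  by (simp add: matrix_vector_mul_assoc[symmetric] inner_matrix_vector[of "conj_transpose A"]
      power2_norm_eq_inner)

lemma pos_def_add_pos_semidef: "pos_def A \<Longrightarrow> pos_semidef B \<Longrightarrow> pos_def (A + B)"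
  unfolding pos_def_iff pos_semidef_iff
  by (auto intro!: hermitian_intros simp: matrix_vector_linear inner_left_distrib add_pos_nonneg)

lemma pos_def_scaleR: "pos_def A \<Longrightarrow> 0 < r \<Longrightarrow> pos_def (r *\<^sub>R A)"
  unfolding pos_def_iff by (auto intro!: hermitian_intros simp: matrix_vector_linear)

lemma matrix_inv_mult:
  assumes "invertible (A :: 'a::semiring_1 ^ 'n ^ 'n)"
  shows "A ** matrix_inv A = mat 1" "matrix_inv A ** A = mat 1"
proof -
  have "A ** matrix_inv A = mat 1 \<and> matrix_inv A ** A = mat 1"
    using assms unfolding invertible_def matrix_inv_def by (rule someI_ex)
  then show "A ** matrix_inv A = mat 1" "matrix_inv A ** A = mat 1"
    by auto
qed

lemma matrix_inv_unique:
  fixes A B :: "complex ^ 'n ^ 'n"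
  assumes "A ** B = mat 1"
  shows "matrix_inv A = B"
proof -
  have inv: "invertible A"
    using assms by (auto simp: invertible_right_inverse)
  have "matrix_inv A = matrix_inv A ** (A ** B)"
    by (simp add: assms)
  also have "\<dots> = B"
    by (simp add: matrix_mul_assoc matrix_inv_mult[OF inv])
  finally show ?thesis .
qed

lemma pos_def_invertible: "pos_def A \<Longrightarrow> invertible A"
  unfolding invertible_left_inverse matrix_left_invertible_ker pos_def_iff
  by (metis inner_zero_left less_irrefl)

lemma matrix_inv_vector:
  assumes "pos_def A"
  shows "A *v (matrix_inv A *v x) = x" "matrix_inv A *v (A *v x) = x"
  by (simp_all add: matrix_vector_mul_assoc matrix_inv_mult[OF pos_def_invertible[OF assms]])

lemma pos_def_matrix_inv:
  assumes "pos_def A"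
  shows "pos_def (matrix_inv (A :: complex ^ 'n ^ 'n))"
  unfolding pos_def_iff
proof (intro conjI allI impI)
  have "conj_transpose (matrix_inv A) ** A = mat 1"
    using assms matrix_inv_mult(1)[OF pos_def_invertible[OF assms]]
    by (metis conj_transpose_mat_1 conj_transpose_mult hermitian_def pos_def_iff)
  then show "hermitian (matrix_inv A)"
    unfolding hermitian_def using matrix_inv_unique matrix_left_right_inverse by metis
  fix x :: "complex ^ 'n" assume "x \<noteq> 0"
  then have "matrix_inv A *v x \<noteq> 0"
    using matrix_inv_vector(1)[OF assms] by (metis matrix_vector_linear(8))
  then have "0 < (A *v (matrix_inv A *v x)) \<bullet> (matrix_inv A *v x)"
    using assms pos_def_iff by blast
  then show "0 < (matrix_inv A *v x) \<bullet> x"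
    by (simp add: matrix_inv_vector[OF assms] inner_commute)
qed

lemma matrix_inv_matrix_inv: "pos_def A \<Longrightarrow> matrix_inv (matrix_inv A) = A"
  by (intro matrix_inv_unique matrix_inv_mult pos_def_invertible)

text \<open>The form of the inverse is a supremum of functions affine in \<open>A\<close> and \<open>x\<close>, attained at
\<open>z = A\<^sup>-\<^sup>1 x\<close>. This one inequality yields the antitonicity of the inverse, the joint convexity
of \<open>\<langle>A\<^sup>-\<^sup>1 x, x\<rangle>\<close>, and the Cauchy-Schwarz inequalities between the averages of a weight and of its
inverse.\<close>

lemma matrix_inv_inner_ge:
  assumes "pos_def A"
  shows "2 * (x \<bullet> z) - (A *v z) \<bullet> z \<le> (matrix_inv A *v x) \<bullet> x"
proof -
  define w where "w = matrix_inv A *v x"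
  have x: "x = A *v w"
    by (simp add: w_def matrix_inv_vector[OF assms])
  have "0 \<le> (A *v (w - z)) \<bullet> (w - z)"
    using pos_def_imp_pos_semidef[OF assms] pos_semidef_iff by blast
  also have "\<dots> = x \<bullet> w - x \<bullet> z - (A *v z) \<bullet> w + (A *v z) \<bullet> z"
    by (simp add: matrix_vector_linear x algebra_simps inner_diff)
  also have "(A *v z) \<bullet> w = x \<bullet> z"
    using assms hermitianD[of A z w] by (simp add: pos_def_iff x inner_commute)
  finally show ?thesis
    by (simp add: w_def[symmetric] inner_commute)
qed

lemma matrix_inv_antimono:
  assumes "pos_def A" "pos_def B" "\<And>x. (A *v x) \<bullet> x \<le> (B *v x) \<bullet> x"
  shows "(matrix_inv B *v x) \<bullet> x \<le> (matrix_inv A *v x) \<bullet> x"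
proof -
  define z where "z = matrix_inv B *v x"
  have "2 * (x \<bullet> z) - (B *v z) \<bullet> z \<le> 2 * (x \<bullet> z) - (A *v z) \<bullet> z"
    using assms(3) by simp
  also have "\<dots> \<le> (matrix_inv A *v x) \<bullet> x"
    by (rule matrix_inv_inner_ge[OF assms(1)])
  finally show ?thesis
    by (simp add: z_def matrix_inv_vector[OF assms(2)] inner_commute)
qed

lemma matrix_inv_scaleR:
  assumes "pos_def A" "r > 0"
  shows "matrix_inv (r *\<^sub>R A) = (1 / r) *\<^sub>R matrix_inv A"
  by (rule matrix_inv_unique)
     (use assms matrix_inv_mult[OF pos_def_invertible[OF assms(1)]] in \<open>simp add:
        linear_scale[OF linear_matrix_mult_left] linear_scale[OF linear_matrix_mult_right]\<close>)

section \<open>The spectral theorem for Hermitian matrices\<close>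

text \<open>A family indexed by a proper subset of the index type of the space does not span: the matrix with the
given vectors as rows, padded by zero rows, is singular.\<close>

lemma exists_cinner_orthogonal:
  fixes u :: "'n \<Rightarrow> complex ^ 'n"
  assumes "k \<notin> S"
  shows "\<exists>x. x \<noteq> 0 \<and> (\<forall>i\<in>S. cinner x (u i) = 0)"
proof -
  define M :: "complex ^ 'n ^ 'n" where "M = (\<chi> i j. if i \<in> S then cnj (u i $ j) else 0)"
  have "row k M = 0"
    using assms by (simp add: M_def row_def vec_eq_iff)
  then have "det M = 0"
    by (rule det_zero_row)
  then have "\<not> invertible M"
    by (simp add: invertible_det_nz)
  then obtain x where x: "M *v x = 0" "x \<noteq> 0"
    unfolding invertible_left_inverse matrix_left_invertible_ker by blast
  have "cinner x (u i) = 0" if "i \<in> S" for i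
  proof -
    have "cinner x (u i) = (M *v x) $ i"
      using that by (simp add: cinner_def matrix_vector_mult_def M_def mult.commute)
    then show ?thesis using x by simp
  qed
  with x show ?thesis by blast
qed

lemma cinner_linear:
  "cinner (x + y) z = cinner x z + cinner y z"
  "cinner (x - y) z = cinner x z - cinner y z"
  "cinner (r *\<^sub>R x) z = r *\<^sub>R cinner x z"
  "cinner (c *s x) z = c * cinner x z"
  by (simp_all add: cinner_def sum.distrib sum_subtractf algebra_simps scaleR_sum_right sum_distrib_left)

lemma cinner_commute: "cinner y x = cnj (cinner x y)"
  by (simp add: cinner_def mult.commute)

lemma cinner_self: "cinner x x = complex_of_real ((norm x)\<^sup>2)"
proof -
  have "Re (cinner x x) = (norm x)\<^sup>2"
    by (simp add: Re_cinner power2_norm_eq_inner)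
  moreover have "Im (cinner x x) = 0"
    by (simp add: cinner_def)
  ultimately show ?thesis
    by (simp add: complex_eq_iff)
qed

lemma cinner_hermitian:
  assumes "hermitian A"
  shows "cinner (A *v x) y = cinner x (A *v y)"
proof -
  have re: "Re (cinner (A *v x) y) = Re (cinner x (A *v y))" for x y
    unfolding Re_cinner by (rule hermitianD[OF assms])
  \<comment> \<open>The real identity at \<open>\<i> x\<close> is the identity of imaginary parts at \<open>x\<close>.\<close>
  have "Im (cinner (A *v x) y) = Im (cinner x (A *v y))"
    using re[of "\<i> *s x" y] by (simp add: vector_scalar_commute cinner_linear)
  then show ?thesis
    using re by (simp add: complex_eq_iff)
qed

text \<open>On an invariant subspace the Rayleigh quotient has a maximizer \<open>x\<close>, and its first variation in the
direction \<open>y\<close> of the component of \<open>A x\<close> orthogonal to \<open>x\<close> is \<open>2 |y|\<^sup>2\<close>, so that \<open>y = 0\<close>.\<close>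

lemma rayleigh_maximizer:
  fixes A :: "complex ^ 'n ^ 'n"
  assumes A: "hermitian A" and E: "subspace E" "\<And>x. x \<in> E \<Longrightarrow> A *v x \<in> E" and ne: "\<exists>x\<in>E. x \<noteq> 0"
  shows "\<exists>x\<in>E. norm x = 1 \<and> (\<exists>d::real. A *v x = d *\<^sub>R x)"
proof -
  have "compact (sphere 0 1 \<inter> E)"
    by (intro compact_Int_closed closed_subspace E) auto
  moreover have "sphere 0 1 \<inter> E \<noteq> {}"
  proof -
    obtain y where "y \<in> E" "y \<noteq> 0" using ne by blast
    then have "(1 / norm y) *\<^sub>R y \<in> sphere 0 1 \<inter> E"
      using E(1) by (auto simp: subspace_scale)
    then show ?thesis by blast
  qed
  moreover have "continuous_on (sphere 0 1 \<inter> E) (\<lambda>x. (A *v x) \<bullet> x)"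
    by (intro continuous_intros linear_continuous_on linear_conv_bounded_linear[THEN iffD1]
        linear_matrix_vector_right)
  ultimately obtain x where x: "x \<in> sphere 0 1 \<inter> E"
    and max: "\<And>y. y \<in> sphere 0 1 \<inter> E \<Longrightarrow> (A *v y) \<bullet> y \<le> (A *v x) \<bullet> x"
    using continuous_attains_sup[of "sphere 0 1 \<inter> E" "\<lambda>x. (A *v x) \<bullet> x"] by blast
  define d where "d = (A *v x) \<bullet> x"
  have xx: "x \<bullet> x = 1" and xE: "x \<in> E"
    using x by (auto simp: norm_eq_1)
  have max': "(A *v y) \<bullet> y \<le> d * (y \<bullet> y)" if "y \<in> E" for y
  proof (cases "y = 0")
    case False
    have "(1 / norm y) *\<^sub>R y \<in> sphere 0 1 \<inter> E"
      using that False E(1) by (auto simp: subspace_scale)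
    from max[OF this] show ?thesis
      using False by (simp add: matrix_vector_linear d_def field_simps dot_square_norm power2_eq_square)
  qed (simp add: matrix_vector_linear)
  define y where "y = A *v x - d *\<^sub>R x"
  have yE: "y \<in> E"
    unfolding y_def using E xE by (simp add: subspace_diff subspace_scale)
  have xy: "x \<bullet> y = 0"
    by (simp add: y_def inner_diff xx d_def inner_commute)
  have Axy: "(A *v x) \<bullet> y = y \<bullet> y"
    by (simp add: y_def inner_diff inner_commute xx d_def)
  have ineq: "2 * t * (y \<bullet> y) \<le> t\<^sup>2 * (d * (y \<bullet> y) - (A *v y) \<bullet> y)" for t :: real
  proof -
    have "(A *v (x + t *\<^sub>R y)) \<bullet> (x + t *\<^sub>R y) \<le> d * ((x + t *\<^sub>R y) \<bullet> (x + t *\<^sub>R y))"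
      by (intro max' subspace_add subspace_scale E xE yE)
    also have "d * ((x + t *\<^sub>R y) \<bullet> (x + t *\<^sub>R y)) = d + t\<^sup>2 * (d * (y \<bullet> y))"
      using xy by (simp add: inner_add xx inner_commute[of y x] algebra_simps power2_eq_square)
    also have "(A *v (x + t *\<^sub>R y)) \<bullet> (x + t *\<^sub>R y)
        = d + t * ((A *v x) \<bullet> y) + t * ((A *v y) \<bullet> x) + t\<^sup>2 * ((A *v y) \<bullet> y)"
      by (simp add: matrix_vector_linear inner_add d_def[symmetric] algebra_simps power2_eq_square)
    also have "(A *v y) \<bullet> x = y \<bullet> y"
      by (metis Axy hermitianD[OF A] inner_commute)
    finally show ?thesis
      by (simp add: Axy algebra_simps)
  qed
  have "y = 0"
  proof (rule ccontr)
    assume "y \<noteq> 0"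
    define c where "c = d * (y \<bullet> y) - (A *v y) \<bullet> y"
    have c0: "0 \<le> c" using max'[OF yE] by (simp add: c_def)
    have yy: "0 < y \<bullet> y" using \<open>y \<noteq> 0\<close> by simp
    \<comment> \<open>The step size makes the linear term win; adding \<open>1\<close> to \<open>c\<close> avoids a vanishing denominator.\<close>
    have "2 * ((y \<bullet> y) / (c + 1)) * (y \<bullet> y) \<le> ((y \<bullet> y) / (c + 1))\<^sup>2 * c"
      using ineq[of "(y \<bullet> y) / (c + 1)"] by (simp add: c_def)
    also have "\<dots> \<le> ((y \<bullet> y) / (c + 1))\<^sup>2 * (c + 1)"
      by (intro mult_left_mono) auto
    also have "\<dots> = ((y \<bullet> y) / (c + 1)) * (y \<bullet> y)"
      using c0 by (simp add: power2_eq_square)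
    finally have "(y \<bullet> y) / (c + 1) * (y \<bullet> y) \<le> 0"
      by simp
    moreover have "0 < (y \<bullet> y) / (c + 1) * (y \<bullet> y)"
      using yy c0 by (intro mult_pos_pos divide_pos_pos) auto
    ultimately show False
      by linarith
  qed
  then show ?thesis
    using x xE by (auto simp: y_def intro!: bexI[of _ x] exI[of _ d])
qed

text \<open>Eigenvectors are added one at a time. The index set of the family is a subset of the index type of the
space, so that at \<open>UNIV\<close> the family is the columns of a square matrix.\<close>

lemma hermitian_orthonormal_eigenvectors:
  fixes A :: "complex ^ 'n ^ 'n" and S :: "'n set"
  assumes A: "hermitian A"
  shows "\<exists>u d. (\<forall>i\<in>S. A *v u i = (d i :: real) *\<^sub>R u i) \<and>
    (\<forall>i\<in>S. \<forall>j\<in>S. cinner (u i) (u j) = (if i = j then 1 else 0))"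
proof (induction S rule: finite_induct[OF finite_class.finite])
  case 1
  then show ?case by simp
next
  case (2 k S)
  then obtain u :: "'n \<Rightarrow> complex ^ 'n" and d :: "'n \<Rightarrow> real"
    where ev: "\<And>i. i \<in> S \<Longrightarrow> A *v u i = d i *\<^sub>R u i"
    and on: "\<And>i j. i \<in> S \<Longrightarrow> j \<in> S \<Longrightarrow> cinner (u i) (u j) = (if i = j then 1 else 0)"
    by blast
  define E where "E = {x. \<forall>i\<in>S. cinner x (u i) = 0}"
  have sub: "subspace E"
    unfolding subspace_def E_def by (auto simp: cinner_linear) (simp add: cinner_def)
  have inv: "A *v x \<in> E" if "x \<in> E" for x
    unfolding E_def
  proof (safe)
    fix i assume i: "i \<in> S"
    have "cinner (A *v x) (u i) = cnj (cinner (d i *\<^sub>R u i) x)"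
      by (simp add: cinner_hermitian[OF A] ev[OF i] cinner_commute[of x])
    also have "\<dots> = d i *\<^sub>R cinner x (u i)"
      by (simp add: cinner_linear cinner_commute[of "u i" x])
    finally show "cinner (A *v x) (u i) = 0"
      using that i by (simp add: E_def)
  qed
  obtain x l where x: "x \<in> E" "norm x = 1" "A *v x = l *\<^sub>R x"
    using rayleigh_maximizer[OF A sub inv] exists_cinner_orthogonal[OF 2(2), of u]
    by (auto simp: E_def)
  have xu: "cinner x (u i) = 0" "cinner (u i) x = 0" if "i \<in> S" for i
    using x(1) that cinner_commute[of "u i" x] by (auto simp: E_def)
  have xx: "cinner x x = 1"
    by (simp add: cinner_self x)
  show ?case
  proof (intro exI[of _ "u(k := x)"] exI[of _ "d(k := l)"] conjI ballI)
    fix i assume "i \<in> insert k S"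
    then show "A *v (u(k := x)) i = (d(k := l)) i *\<^sub>R (u(k := x)) i"
      using 2(2) ev x(3) by auto
    fix j assume "j \<in> insert k S"
    with \<open>i \<in> insert k S\<close>
    show "cinner ((u(k := x)) i) ((u(k := x)) j) = (if i = j then 1 else 0)"
      using 2(2) on xu xx by auto
  qed
qed

definition diag :: "('n \<Rightarrow> real) \<Rightarrow> complex ^ 'n ^ 'n" where
  "diag d = (\<chi> i j. if i = j then complex_of_real (d i) else 0)"

lemma conj_transpose_diag [simp]: "conj_transpose (diag d) = diag d"
  by (auto simp: vec_eq_iff diag_def)

lemma diag_mult: "diag a ** diag b = diag (\<lambda>i. a i * b i)"
  by (auto simp: vec_eq_iff diag_def matrix_matrix_mult_def mult_delta_left mult_delta_right)

lemma diag_vector: "(diag d *v x) $ i = complex_of_real (d i) * x $ i"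
  by (simp add: diag_def matrix_vector_mult_def mult_delta_left mult_delta_right)

lemma det_diag: "det (diag d) = complex_of_real (\<Prod>i\<in>UNIV. d i)"
  by (subst det_diagonal) (auto simp: diag_def)

theorem hermitian_spectral_decomposition:
  fixes A :: "complex ^ 'n ^ 'n"
  assumes "hermitian A"
  obtains U :: "complex ^ 'n ^ 'n" and d where "conj_transpose U ** U = mat 1" "U ** conj_transpose U = mat 1"
    "A = U ** diag d ** conj_transpose U"
proof -
  obtain u and d :: "'n \<Rightarrow> real"
    where ev: "\<And>i. A *v u i = d i *\<^sub>R u i"
    and on: "\<And>i j. cinner (u i) (u j) = (if i = j then 1 else 0)"
    using hermitian_orthonormal_eigenvectors[OF assms, of UNIV] by blast
  define U :: "complex ^ 'n ^ 'n" where "U = (\<chi> i j. u j $ i)"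
  have 1: "conj_transpose U ** U = mat 1"
    using on by (auto simp: vec_eq_iff U_def matrix_matrix_mult_def mat_def cinner_def mult.commute)
  then have 2: "U ** conj_transpose U = mat 1"
    using matrix_left_right_inverse by blast
  have "A ** U = U ** diag d"
  proof -
    have "(A ** U) $ i $ j = (U ** diag d) $ i $ j" for i j
    proof -
      have "(A ** U) $ i $ j = (A *v u j) $ i"
        by (simp add: matrix_matrix_mult_def matrix_vector_mult_def U_def)
      also have "\<dots> = complex_of_real (d j) * u j $ i"
        unfolding ev vector_scaleR_component by (rule scaleR_conv_of_real)
      also have "\<dots> = (U ** diag d) $ i $ j"
        by (simp add: matrix_matrix_mult_def U_def diag_def mult_delta_left mult_delta_right)
      finally show ?thesis .
    qed
    then show ?thesis by (simp add: vec_eq_iff)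
  qed
  then have "A = U ** diag d ** conj_transpose U"
    by (metis 2 matrix_mul_assoc matrix_mul_rid)
  with 1 2 show thesis by (rule that)
qed

section \<open>Square roots and the trace inner product\<close>

lemma norm_matrix_vector_le:
  fixes A :: "complex ^ 'n ^ 'm"
  shows "norm (A *v x) \<le> norm A * norm x"
proof -
  have row: "norm ((A *v x) $ i) \<le> norm (A $ i) * norm x" for i
  proof -
    have "norm ((A *v x) $ i) \<le> (\<Sum>j\<in>UNIV. \<bar>norm (A $ i $ j)\<bar> * \<bar>norm (x $ j)\<bar>)"
      unfolding matrix_vector_mult_def by (auto simp: norm_mult[symmetric] intro: norm_sum)
    also have "\<dots> \<le> norm (A $ i) * norm x"
      unfolding norm_vec_def by (rule L2_set_mult_ineq)
    finally show ?thesis .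
  qed
  have "norm (A *v x) \<le> L2_set (\<lambda>i. norm x * norm (A $ i)) UNIV"
    unfolding norm_vec_def[of "A *v x"] using row
    by (intro L2_set_mono) (auto simp: mult.commute)
  also have "\<dots> = norm A * norm x"
    by (simp add: L2_set_right_distrib[symmetric] norm_vec_def[of A] mult.commute)
  finally show ?thesis .
qed

lemma spectral_eigenvector:
  fixes A U :: "complex ^ 'n ^ 'n"
  assumes "conj_transpose U ** U = mat 1" "A = U ** diag d ** conj_transpose U"
  shows "A *v (U *v axis i 1) = d i *\<^sub>R (U *v axis i 1)" "norm (U *v axis i 1) = 1"
proof -
  have UU: "conj_transpose U *v (U *v y) = y" for y
    by (simp add: matrix_vector_mul_assoc assms(1))
  have "diag d *v axis i 1 = d i *\<^sub>R (axis i 1 :: complex ^ 'n)"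
    by (simp add: vec_eq_iff diag_vector axis_def scaleR_conv_of_real[where 'a=complex])
  then show "A *v (U *v axis i 1) = d i *\<^sub>R (U *v axis i 1)"
    by (simp add: assms(2) matrix_vector_mul_assoc[symmetric] UU matrix_vector_linear)
  have "(U *v axis i 1) \<bullet> (U *v axis i 1) = axis i 1 \<bullet> (axis i 1 :: complex ^ 'n)"
    by (simp add: inner_matrix_vector UU)
  then show "norm (U *v axis i 1) = 1"
    by (simp add: norm_eq_1 inner_axis_axis)
qed

lemma pos_semidef_square_root_exists:
  fixes A :: "complex ^ 'n ^ 'n"
  assumes "pos_semidef A"
  shows "\<exists>B. pos_semidef B \<and> B ** B = A"
proof -
  obtain U :: "complex ^ 'n ^ 'n" and d where U: "conj_transpose U ** U = mat 1"
    and A: "A = U ** diag d ** conj_transpose U"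
    using assms hermitian_spectral_decomposition pos_semidef_iff by metis
  have d: "0 \<le> d i" for i
  proof -
    have "0 \<le> (A *v (U *v axis i 1)) \<bullet> (U *v axis i 1)"
      using assms pos_semidef_iff by blast
    then show ?thesis
      using spectral_eigenvector(2)[OF U A, of i]
      by (simp add: spectral_eigenvector(1)[OF U A] norm_eq_1)
  qed
  \<comment> \<open>Fourth roots exhibit \<open>B\<close> as a Gram matrix, hence as positive semidefinite.\<close>
  define S where "S = diag (\<lambda>i. sqrt (sqrt (d i))) ** conj_transpose U"
  define B where "B = U ** diag (\<lambda>i. sqrt (d i)) ** conj_transpose U"
  have "conj_transpose S ** S = U ** (diag (\<lambda>i. sqrt (sqrt (d i))) ** diag (\<lambda>i. sqrt (sqrt (d i)))) ** conj_transpose U"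
    by (simp add: S_def conj_transpose_mult matrix_mul_assoc)
  also have "\<dots> = B"
    using d by (simp add: diag_mult B_def)
  finally have "pos_semidef B"
    using pos_semidef_gram by metis
  moreover have "B ** B = A"
  proof -
    have "B ** B = U ** diag (\<lambda>i. sqrt (d i)) ** (conj_transpose U ** U) ** diag (\<lambda>i. sqrt (d i)) ** conj_transpose U"
      by (simp add: B_def matrix_mul_assoc)
    also have "\<dots> = U ** (diag (\<lambda>i. sqrt (d i)) ** diag (\<lambda>i. sqrt (d i))) ** conj_transpose U"
      by (simp add: U matrix_mul_assoc)
    also have "\<dots> = A"
      using d by (simp add: diag_mult A)
    finally show ?thesis .
  qed
  ultimately show ?thesis by blast
qed

text \<open>If \<open>x\<close> is a unit eigenvector of \<open>B - C\<close> with eigenvalue \<open>d\<close>, then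
\<open>0 = |B x|\<^sup>2 - |C x|\<^sup>2 = d (\<langle>B x, x\<rangle> + \<langle>C x, x\<rangle>)\<close>, and vanishing of the second factor forces
\<open>\<langle>B x, x\<rangle> = \<langle>C x, x\<rangle> = 0\<close>, hence again \<open>d = 0\<close>.\<close>

lemma pos_semidef_square_root_unique:
  fixes B C :: "complex ^ 'n ^ 'n"
  assumes B: "pos_semidef B" and C: "pos_semidef C" and eq: "B ** B = C ** C"
  shows "B = C"
proof -
  have herm: "hermitian B" "hermitian C" and nn: "0 \<le> (B *v x) \<bullet> x" "0 \<le> (C *v x) \<bullet> x" for x
    using B C by (auto simp: pos_semidef_iff)
  obtain U :: "complex ^ 'n ^ 'n" and d where U: "conj_transpose U ** U = mat 1"
    and E: "B - C = U ** diag d ** conj_transpose U"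
    using herm hermitian_spectral_decomposition hermitian_intros(2) by metis
  have "d i = 0" for i
  proof -
    define x where "x = U *v axis i 1"
    have Ex: "B *v x - C *v x = d i *\<^sub>R x" and nx: "x \<bullet> x = 1"
      using spectral_eigenvector[OF U E, of i] by (auto simp: x_def matrix_vector_linear norm_eq_1)
    have "(B *v x) \<bullet> (B *v x) = (C *v x) \<bullet> (C *v x)"
      using herm eq by (metis hermitianD matrix_vector_mul_assoc)
    then have "0 = (B *v x - C *v x) \<bullet> (B *v x + C *v x)"
      by (simp add: inner_diff_left inner_diff_right inner_add_right inner_add_left inner_commute)
    also have "\<dots> = d i * ((B *v x) \<bullet> x + (C *v x) \<bullet> x)"
      by (simp add: Ex inner_add_right inner_commute distrib_left)
    finally have "d i = 0 \<or> (B *v x) \<bullet> x + (C *v x) \<bullet> x = 0"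
      by simp
    moreover have "d i = (B *v x) \<bullet> x - (C *v x) \<bullet> x"
      using arg_cong[OF Ex, of "\<lambda>y. y \<bullet> x"] by (simp add: inner_diff_left nx)
    ultimately show ?thesis
      using nn[of x] by linarith
  qed
  then have "diag d = 0"
    by (simp add: diag_def vec_eq_iff)
  then show ?thesis
    using E by (simp add: linear_0[OF linear_matrix_mult_left] linear_0[OF linear_matrix_mult_right])
qed

lemma mat_sqrt:
  assumes "pos_semidef A"
  shows "pos_semidef (mat_sqrt A)" "mat_sqrt A ** mat_sqrt A = A"
proof -
  have "\<exists>!B. pos_semidef B \<and> B ** B = A"
    using pos_semidef_square_root_exists[OF assms] pos_semidef_square_root_unique by blast
  then have "pos_semidef (mat_sqrt A) \<and> mat_sqrt A ** mat_sqrt A = A"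
    unfolding mat_sqrt_def by (rule theI')
  then show "pos_semidef (mat_sqrt A)" "mat_sqrt A ** mat_sqrt A = A"
    by auto
qed

lemma hermitian_mat_sqrt: "pos_semidef A \<Longrightarrow> hermitian (mat_sqrt A)"
  using mat_sqrt(1) pos_semidef_iff by blast

lemma norm_mat_sqrt_vector:
  assumes "pos_semidef A"
  shows "(norm (mat_sqrt A *v x))\<^sup>2 = (A *v x) \<bullet> x"
  using hermitianD[OF hermitian_mat_sqrt[OF assms], of "mat_sqrt A *v x" x]
  by (simp add: power2_norm_eq_inner matrix_vector_mul_assoc mat_sqrt(2)[OF assms])

lemma pos_def_mat_sqrt:
  assumes "pos_def A"
  shows "pos_def (mat_sqrt A)"
proof -
  have A: "pos_semidef A"
    using assms by (rule pos_def_imp_pos_semidef)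
  have psd: "pos_semidef (mat_sqrt A)"
    by (rule mat_sqrt(1)[OF A])
  show ?thesis
    unfolding pos_def_iff
  proof (intro conjI allI impI)
    show "hermitian (mat_sqrt A)"
      by (rule hermitian_mat_sqrt[OF A])
    fix x :: "complex ^ 'a" assume "x \<noteq> 0"
    then have "0 < (norm (mat_sqrt A *v x))\<^sup>2"
      unfolding norm_mat_sqrt_vector[OF A] using assms pos_def_iff by blast
    then have "mat_sqrt A *v x \<noteq> 0"
      by auto
    then have "mat_sqrt (mat_sqrt A) *v x \<noteq> 0"
      using mat_sqrt(2)[OF psd] by (metis matrix_vector_linear(8) matrix_vector_mul_assoc)
    then show "0 < (mat_sqrt A *v x) \<bullet> x"
      by (simp add: norm_mat_sqrt_vector[OF psd, symmetric])
  qed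
qed

lemma inner_pos_semidef_nonneg:
  assumes "pos_semidef A" "pos_semidef B"
  shows "0 \<le> A \<bullet> B"
proof -
  have "A \<bullet> B = A \<bullet> (mat_sqrt B ** conj_transpose (mat_sqrt B))"
    using mat_sqrt(2)[OF assms(2)] hermitian_mat_sqrt[OF assms(2)] by (simp add: hermitian_def)
  also have "\<dots> = (A ** mat_sqrt B) \<bullet> mat_sqrt B"
    by (rule inner_matrix_mult_right[symmetric])
  also have "\<dots> = (\<Sum>j\<in>UNIV. (A *v (mat_sqrt B *v axis j 1)) \<bullet> (mat_sqrt B *v axis j 1))"
    by (simp add: inner_matrix_columns matrix_vector_mul_assoc)
  also have "\<dots> \<ge> 0"
    using assms(1) by (intro sum_nonneg) (auto simp: pos_semidef_iff)
  finally show ?thesis .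
qed

lemma norm_mat_sqrt_mult:
  assumes "pos_semidef A" "pos_semidef B"
  shows "(norm (mat_sqrt A ** mat_sqrt B))\<^sup>2 = A \<bullet> B"
proof -
  have "(norm (mat_sqrt A ** mat_sqrt B))\<^sup>2 = mat_sqrt B \<bullet> (A ** mat_sqrt B)"
    using hermitian_mat_sqrt[OF assms(1)] mat_sqrt(2)[OF assms(1)]
    by (simp add: power2_norm_eq_inner inner_matrix_mult_left hermitian_def matrix_mul_assoc)
  also have "\<dots> = A \<bullet> B"
    using hermitian_mat_sqrt[OF assms(2)] mat_sqrt(2)[OF assms(2)]
    by (subst inner_commute) (simp add: inner_matrix_mult_right hermitian_def)
  finally show ?thesis .
qed

text \<open>With \<open>x = W\<^sup>-\<^sup>1\<^sup>/\<^sup>2 y\<close> the form is \<open>|Q\<^sup>1\<^sup>/\<^sup>2 W\<^sup>-\<^sup>1\<^sup>/\<^sup>2 y|\<^sup>2\<close>, and the squared Frobenius norm of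
\<open>Q\<^sup>1\<^sup>/\<^sup>2 W\<^sup>-\<^sup>1\<^sup>/\<^sup>2\<close> is \<open>W\<^sup>-\<^sup>1 \<bullet> Q\<close>. Every passage from a bound on a trace to an inequality of
quadratic forms goes through this lemma.\<close>

lemma quadratic_form_le_inner:
  assumes W: "pos_def W" and Q: "pos_semidef Q"
  shows "(Q *v x) \<bullet> x \<le> (matrix_inv W \<bullet> Q) * ((W *v x) \<bullet> x)"
proof -
  define T where "T = mat_sqrt W"
  have T: "pos_def T"
    unfolding T_def by (rule pos_def_mat_sqrt[OF W])
  have TT: "T ** T = W" and Ws: "pos_semidef W"
    using W by (auto simp: T_def mat_sqrt pos_def_imp_pos_semidef)
  have iT: "matrix_inv T ** matrix_inv T = matrix_inv W"
  proof -
    have "W ** (matrix_inv T ** matrix_inv T) = T ** (T ** matrix_inv T) ** matrix_inv T"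
      by (simp add: TT[symmetric] matrix_mul_assoc)
    then show ?thesis
      by (intro matrix_inv_unique[symmetric]) (simp add: matrix_inv_mult[OF pos_def_invertible[OF T]])
  qed
  have hT: "conj_transpose (matrix_inv T) = matrix_inv T"
    using pos_def_matrix_inv[OF T] by (simp add: pos_def_iff hermitian_def)
  have hS: "conj_transpose (mat_sqrt Q) = mat_sqrt Q"
    using hermitian_mat_sqrt[OF Q] by (simp add: hermitian_def)
  have "(Q *v x) \<bullet> x = (norm (mat_sqrt Q *v x))\<^sup>2"
    by (rule norm_mat_sqrt_vector[OF Q, symmetric])
  also have "mat_sqrt Q *v x = (mat_sqrt Q ** matrix_inv T) *v (T *v x)"
    by (simp add: matrix_vector_mul_assoc[symmetric] matrix_inv_vector[OF T])
  also have "(norm \<dots>)\<^sup>2 \<le> (norm (mat_sqrt Q ** matrix_inv T) * norm (T *v x))\<^sup>2"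
    by (intro power_mono norm_matrix_vector_le norm_ge_zero)
  also have "\<dots> = (norm (mat_sqrt Q ** matrix_inv T))\<^sup>2 * ((W *v x) \<bullet> x)"
    by (simp add: power_mult_distrib T_def norm_mat_sqrt_vector[OF Ws])
  also have "(norm (mat_sqrt Q ** matrix_inv T))\<^sup>2 = (Q ** matrix_inv T) \<bullet> matrix_inv T"
    using mat_sqrt(2)[OF Q]
    by (simp add: power2_norm_eq_inner inner_matrix_mult_left hS matrix_mul_assoc inner_commute)
  also have "\<dots> = Q \<bullet> matrix_inv W"
    by (simp add: inner_matrix_mult_right hT iT)
  finally show ?thesis
    by (simp add: inner_commute)
qed

section \<open>The logarithm of the determinant\<close>

text \<open>The determinant of a positive definite matrix is a positive real, so the real part loses nothing.\<close>

definition ln_det :: "complex ^ 'n ^ 'n \<Rightarrow> real" where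
  "ln_det A = ln (Re (det A))"

lemma pos_def_det_trace:
  fixes A :: "complex ^ 'n ^ 'n"
  assumes "pos_def A"
  obtains d :: "'n \<Rightarrow> real" where "\<And>i. 0 < d i" "det A = complex_of_real (\<Prod>i\<in>UNIV. d i)"
    "mat 1 \<bullet> A = (\<Sum>i\<in>UNIV. d i)"
proof -
  obtain U :: "complex ^ 'n ^ 'n" and d where U: "conj_transpose U ** U = mat 1"
    and A: "A = U ** diag d ** conj_transpose U"
    using assms hermitian_spectral_decomposition pos_def_iff by metis
  have "0 < d i" for i
  proof -
    have "U *v axis i 1 \<noteq> 0"
      using spectral_eigenvector(2)[OF U A, of i] by auto
    then have "0 < (A *v (U *v axis i 1)) \<bullet> (U *v axis i 1)"
      using assms pos_def_iff by blast
    then show ?thesis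
      using spectral_eigenvector(2)[OF U A, of i]
      by (simp add: spectral_eigenvector(1)[OF U A] norm_eq_1)
  qed
  moreover have "det A = complex_of_real (\<Prod>i\<in>UNIV. d i)"
  proof -
    have "det A = det (diag d) * det (conj_transpose U ** U)"
      by (simp add: A det_mul ac_simps)
    then show ?thesis by (simp add: U det_diag)
  qed
  moreover have "mat 1 \<bullet> A = (\<Sum>i\<in>UNIV. d i)"
  proof -
    have "mat 1 \<bullet> A = conj_transpose (U ** diag d) \<bullet> conj_transpose U"
      using inner_matrix_mult_left[of "U ** diag d" "conj_transpose U" "mat 1"]
      by (simp add: A inner_commute)
    also have "\<dots> = diag d \<bullet> (conj_transpose U ** U)"
      by (simp only: inner_conj_transpose inner_matrix_mult_left)
    also have "\<dots> = (\<Sum>i\<in>UNIV. d i)"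
      by (simp add: U inner_matrix_eq diag_def mat_def if_distrib[of cnj] mult_delta_left mult_delta_right)
    finally show ?thesis .
  qed
  ultimately show thesis by (rule that)
qed

lemma pos_def_det:
  fixes A :: "complex ^ 'n ^ 'n"
  assumes "pos_def A"
  shows "0 < Re (det A)" "det A = complex_of_real (Re (det A))"
proof -
  obtain d :: "'n \<Rightarrow> real" where "\<And>i. 0 < d i" "det A = complex_of_real (\<Prod>i\<in>UNIV. d i)"
    "mat 1 \<bullet> A = (\<Sum>i\<in>UNIV. d i)"
    using pos_def_det_trace[OF assms] by metis
  then show "0 < Re (det A)" "det A = complex_of_real (Re (det A))"
    by (auto intro!: prod_pos simp del: of_real_prod)
qed

text \<open>\<open>ln d \<le> d - 1\<close>, summed over the eigenvalues.\<close>

lemma ln_det_le_trace: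
  fixes A :: "complex ^ 'n ^ 'n"
  assumes "pos_def A"
  shows "ln_det A \<le> mat 1 \<bullet> A - CARD('n)"
proof -
  obtain d :: "'n \<Rightarrow> real" where d: "\<And>i. 0 < d i" "det A = complex_of_real (\<Prod>i\<in>UNIV. d i)"
    "mat 1 \<bullet> A = (\<Sum>i\<in>UNIV. d i)"
    using pos_def_det_trace[OF assms] by metis
  have "ln_det A = (\<Sum>i\<in>UNIV. ln (d i))"
    using d(1) by (simp add: ln_det_def d(2) ln_prod less_imp_neq[THEN not_sym] del: of_real_prod)
  also have "\<dots> \<le> (\<Sum>i\<in>UNIV. d i - 1)"
    by (intro sum_mono ln_le_minus_one d)
  finally show ?thesis
    by (simp add: d(3) sum_subtractf)
qed

lemma ln_det_mult:
  assumes "pos_def A" "pos_def B"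
  shows "Re (det A * det B) = Re (det A) * Re (det B)" "ln (Re (det A * det B)) = ln_det A + ln_det B"
proof -
  show 1: "Re (det A * det B) = Re (det A) * Re (det B)"
    by (metis pos_def_det(2)[OF assms(1)] pos_def_det(2)[OF assms(2)] Re_complex_of_real of_real_mult)
  show "ln (Re (det A * det B)) = ln_det A + ln_det B"
    unfolding 1 ln_det_def by (intro ln_mult_pos pos_def_det(1) assms)
qed

lemma ln_det_matrix_inv:
  assumes "pos_def A"
  shows "ln_det (matrix_inv A) = - ln_det A"
proof -
  have "det A * det (matrix_inv A) = 1"
    by (simp add: det_mul[symmetric] matrix_inv_mult[OF pos_def_invertible[OF assms]])
  then show ?thesis
    using ln_det_mult(2)[OF assms pos_def_matrix_inv[OF assms]] by simp
qed

text \<open>Concavity of the logarithm of the determinant, in the form of a tangent inequality at \<open>X\<close>: it is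
the trace bound for \<open>X\<^sup>-\<^sup>1\<^sup>/\<^sup>2 Y X\<^sup>-\<^sup>1\<^sup>/\<^sup>2\<close>.\<close>

lemma ln_det_tangent:
  assumes X: "pos_def X" and Y: "pos_def Y"
  shows "ln_det Y \<le> ln_det X + matrix_inv X \<bullet> (Y - X)"
proof -
  define T where "T = mat_sqrt (matrix_inv X)"
  have X': "pos_def (matrix_inv X)" "pos_semidef (matrix_inv X)"
    using X by (auto intro: pos_def_matrix_inv pos_def_imp_pos_semidef)
  have T: "pos_def T" and TT: "T ** T = matrix_inv X"
    using X' by (auto simp: T_def mat_sqrt pos_def_mat_sqrt)
  have hT: "conj_transpose T = T" and hY: "conj_transpose Y = Y"
    using T Y by (auto simp: pos_def_iff hermitian_def)
  define Z where "Z = T ** (Y ** T)"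
  have Z: "pos_def Z"
    unfolding pos_def_iff
  proof (intro conjI allI impI)
    show "hermitian Z"
      by (simp add: Z_def hermitian_def conj_transpose_mult hT hY matrix_mul_assoc)
    fix x :: "complex ^ 'a" assume "x \<noteq> 0"
    then have "T *v x \<noteq> 0"
      using matrix_inv_vector(2)[OF T] by (metis matrix_vector_linear(8))
    then have "0 < (Y *v (T *v x)) \<bullet> (T *v x)"
      using Y pos_def_iff by blast
    then show "0 < (Z *v x) \<bullet> x"
      by (simp add: Z_def matrix_vector_mul_assoc[symmetric] inner_matrix_vector[of T] hT)
  qed
  have "det Z = det (matrix_inv X) * det Y"
    by (simp add: Z_def det_mul TT[symmetric])
  then have "ln_det Z = ln_det Y - ln_det X"
    using ln_det_mult(2)[OF X'(1) Y] by (simp add: ln_det_def[of Z] ln_det_matrix_inv[OF X])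
  moreover have "mat 1 \<bullet> Z = matrix_inv X \<bullet> Y"
  proof -
    have "mat 1 \<bullet> Z = (Y ** T) \<bullet> T"
      using inner_matrix_mult_left[of T "Y ** T" "mat 1"] by (simp add: Z_def hT inner_commute)
    also have "\<dots> = Y \<bullet> matrix_inv X"
      by (simp add: inner_matrix_mult_right hT TT)
    finally show ?thesis
      by (simp only: inner_commute)
  qed
  moreover have "matrix_inv X \<bullet> X = CARD('a)"
  proof -
    have "matrix_inv X \<bullet> X = mat 1 \<bullet> (conj_transpose (matrix_inv X) ** X)"
      using inner_matrix_mult_left[of "matrix_inv X" "mat 1" X] by simp
    also have "conj_transpose (matrix_inv X) ** X = mat 1"
      using X'(1) by (simp add: pos_def_iff hermitian_def matrix_inv_mult pos_def_invertible[OF X])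
    also have "mat 1 \<bullet> (mat 1 :: complex ^ 'a ^ 'a) = CARD('a)"
      by (simp add: inner_matrix_eq mat_def if_distrib[of cnj] mult_delta_left mult_delta_right)
    finally show ?thesis .
  qed
  ultimately show ?thesis
    using ln_det_le_trace[OF Z] by (simp add: inner_diff_right)
qed

section \<open>The Bellman function\<close>

text \<open>The domain of the Bellman function. The parameters stand for the averages over a cube of the weight, of
its inverse, of \<open>|W\<^sup>1\<^sup>/\<^sup>2 f|\<^sup>2\<close> and of \<open>f\<close>, with \<open>N\<close> the normalized packing sum below the cube.\<close>

definition admissible ::
  "real \<Rightarrow> complex ^ 'n ^ 'n \<Rightarrow> complex ^ 'n ^ 'n \<Rightarrow> complex ^ 'n ^ 'n \<Rightarrow> real \<Rightarrow> complex ^ 'n \<Rightarrow> bool" where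
  "admissible k W V N F f \<longleftrightarrow> pos_def W \<and> pos_def V \<and> pos_semidef N \<and> pos_semidef (W - N) \<and>
     (\<forall>x. (matrix_inv V *v x) \<bullet> x \<le> (W *v x) \<bullet> x) \<and> W \<bullet> V \<le> k \<and> (matrix_inv V *v f) \<bullet> f \<le> F"

definition bellman_height where
  "bellman_height k W V N = 1 + (ln_det (W + N) + ln_det V) / (2 * k)"

definition bellman_matrix where
  "bellman_matrix k W V N = 2 *\<^sub>R V - (1 / bellman_height k W V N) *\<^sub>R matrix_inv W"

definition bellman where
  "bellman k W V N F f = F - (matrix_inv (bellman_matrix k W V N) *v f) \<bullet> f"

text \<open>The lower bound is \<open>ln det V\<^sup>-\<^sup>1 \<le> ln det (W + N)\<close>, since \<open>V\<^sup>-\<^sup>1 \<le> W\<close>. The upper bound compares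
\<open>V\<close> with \<open>(W + N)\<^sup>-\<^sup>1\<close> by the tangent inequality, which leaves \<open>(W + N) \<bullet> V \<le> 2 W \<bullet> V\<close>.\<close>

lemma bellman_height_bounds:
  assumes adm: "admissible k W V N F f" and k: "k > 0"
  shows "1 \<le> bellman_height k W V N" "bellman_height k W V N \<le> 2"
proof -
  have W: "pos_def W" and V: "pos_def V" and N: "pos_semidef N" and WN: "pos_semidef (W - N)"
    and inv: "\<And>x. (matrix_inv V *v x) \<bullet> x \<le> (W *v x) \<bullet> x" and WV: "W \<bullet> V \<le> k"
    using adm by (auto simp: admissible_def)
  have V': "pos_def (matrix_inv V)" by (rule pos_def_matrix_inv[OF V])
  have Y: "pos_def (W + N)" by (rule pos_def_add_pos_semidef[OF W N])
  have "- ln_det V \<le> ln_det (W + N) + matrix_inv (W + N) \<bullet> (matrix_inv V - (W + N))"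
    using ln_det_tangent[OF Y V'] by (simp add: ln_det_matrix_inv[OF V])
  moreover have "0 \<le> matrix_inv (W + N) \<bullet> ((W + N) - matrix_inv V)"
  proof (rule inner_pos_semidef_nonneg)
    show "pos_semidef (matrix_inv (W + N))"
      by (intro pos_def_imp_pos_semidef pos_def_matrix_inv Y)
    have "hermitian (W + N - matrix_inv V)"
      using Y V' by (intro hermitian_intros(2)) (auto simp: pos_def_iff)
    moreover have "0 \<le> ((W + N - matrix_inv V) *v x) \<bullet> x" for x
      using inv[of x] N by (auto simp: matrix_vector_linear inner_diff_left inner_add_left pos_semidef_iff add_increasing2)
    ultimately show "pos_semidef (W + N - matrix_inv V)"
      by (simp add: pos_semidef_iff)
  qed
  ultimately have "0 \<le> ln_det (W + N) + ln_det V"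
    by (simp add: inner_diff_right)
  then show "1 \<le> bellman_height k W V N"
    using k by (simp add: bellman_height_def)
  have "ln_det V \<le> ln_det (matrix_inv (W + N)) + (W + N) \<bullet> (V - matrix_inv (W + N))"
    using ln_det_tangent[OF pos_def_matrix_inv[OF Y] V] by (simp add: matrix_inv_matrix_inv[OF Y])
  then have "ln_det (W + N) + ln_det V \<le> (W + N) \<bullet> V - (W + N) \<bullet> matrix_inv (W + N)"
    by (simp add: ln_det_matrix_inv[OF Y] inner_diff_right)
  moreover have "0 \<le> (W + N) \<bullet> matrix_inv (W + N)"
    by (intro inner_pos_semidef_nonneg pos_def_imp_pos_semidef pos_def_matrix_inv Y)
  moreover have "0 \<le> (W - N) \<bullet> V"
    by (intro inner_pos_semidef_nonneg WN pos_def_imp_pos_semidef V)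
  ultimately have "ln_det (W + N) + ln_det V \<le> 2 * k"
    using WV by (simp add: inner_diff_left inner_add_left)
  then show "bellman_height k W V N \<le> 2"
    using k by (simp add: bellman_height_def)
qed

lemma bellman_matrix_bounds:
  assumes adm: "admissible k W V N F f" and k: "k > 0"
  defines "X \<equiv> bellman_matrix k W V N"
  shows "(V *v x) \<bullet> x \<le> (X *v x) \<bullet> x" "(X *v x) \<bullet> x \<le> 2 * ((V *v x) \<bullet> x)" "pos_def X"
proof -
  have W: "pos_def W" and V: "pos_def V"
    and inv: "\<And>x. (matrix_inv V *v x) \<bullet> x \<le> (W *v x) \<bullet> x"
    using adm by (auto simp: admissible_def)
  define h where "h = bellman_height k W V N"
  have h: "1 \<le> h"
    unfolding h_def by (rule bellman_height_bounds[OF adm k])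
  have W': "pos_def (matrix_inv W)" by (rule pos_def_matrix_inv[OF W])
  have eq: "(X *v x) \<bullet> x = 2 * ((V *v x) \<bullet> x) - (1 / h) * ((matrix_inv W *v x) \<bullet> x)" for x
    by (simp add: X_def bellman_matrix_def h_def matrix_vector_linear inner_diff_left)
  have W0: "0 \<le> (matrix_inv W *v x) \<bullet> x" for x
    using pos_def_imp_pos_semidef[OF W'] by (simp add: pos_semidef_iff)
  have WV: "(matrix_inv W *v x) \<bullet> x \<le> (V *v x) \<bullet> x" for x
    using matrix_inv_antimono[OF pos_def_matrix_inv[OF V] W inv, of x]
    by (simp add: matrix_inv_matrix_inv[OF V])
  have low: "(V *v x) \<bullet> x \<le> (X *v x) \<bullet> x" for x
  proof -
    have "(1 / h) * ((matrix_inv W *v x) \<bullet> x) \<le> 1 * ((matrix_inv W *v x) \<bullet> x)"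
      using h W0 by (intro mult_right_mono) auto
    then show ?thesis
      using WV[of x] eq[of x] by linarith
  qed
  show "(V *v x) \<bullet> x \<le> (X *v x) \<bullet> x"
    by (rule low)
  show "(X *v x) \<bullet> x \<le> 2 * ((V *v x) \<bullet> x)"
    using h W0[of x] by (simp add: eq)
  have "hermitian X"
    using V W' unfolding X_def bellman_matrix_def
    by (intro hermitian_intros) (auto simp: pos_def_iff)
  moreover have "0 < (X *v x) \<bullet> x" if "x \<noteq> 0" for x
    using low[of x] V that by (auto simp: pos_def_iff intro: less_le_trans)
  ultimately show "pos_def X"
    by (simp add: pos_def_iff)
qed

lemma bellman_nonneg:
  assumes adm: "admissible k W V N F f" and k: "k > 0"
  shows "0 \<le> bellman k W V N F f"
proof -
  have V: "pos_def V" and F: "(matrix_inv V *v f) \<bullet> f \<le> F"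
    using adm by (auto simp: admissible_def)
  have "(matrix_inv (bellman_matrix k W V N) *v f) \<bullet> f \<le> (matrix_inv V *v f) \<bullet> f"
    by (rule matrix_inv_antimono[OF V bellman_matrix_bounds(3,1)[OF adm k]])
  with F show ?thesis
    by (simp add: bellman_def)
qed

lemma bellman_le:
  assumes adm: "admissible k W V N F f" and k: "k > 0"
  shows "bellman k W V N F f \<le> F"
  using pos_def_imp_pos_semidef[OF pos_def_matrix_inv[OF bellman_matrix_bounds(3)[OF adm k]]]
  by (simp add: bellman_def pos_semidef_iff)

text \<open>The arithmetic-geometric inequality for \<open>a\<close>, \<open>b\<close> and \<open>1 / (a b)\<close>; it is the tangent plane of the
convex function \<open>1 / (a b)\<close> at \<open>(1, 1)\<close>.\<close>

lemma inverse_product_tangent: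
  fixes a b :: real
  assumes "a > 0" "b > 0"
  shows "3 - a - b \<le> 1 / (a * b)"
proof -
  have "ln (1 / (a * b)) \<le> 1 / (a * b) - 1" "ln a \<le> a - 1" "ln b \<le> b - 1"
    using assms by (auto intro!: ln_le_minus_one)
  moreover have "ln (1 / (a * b)) = - ln a - ln b"
    using assms by (simp add: ln_div ln_mult)
  ultimately show ?thesis
    by linarith
qed

text \<open>A cube and its children, reduced to their averages: \<open>c i\<close> is the proportion of the volume that
child \<open>i\<close> takes up, and \<open>P\<close> is what the cube itself adds to the packing sum.\<close>

locale bellman_step =
  fixes k :: real and S :: "'i set" and c :: "'i \<Rightarrow> real"
    and Wc Vc Nc :: "'i \<Rightarrow> complex ^ 'n ^ 'n" and Fc :: "'i \<Rightarrow> real" and fc :: "'i \<Rightarrow> complex ^ 'n"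
    and W V N P :: "complex ^ 'n ^ 'n" and F :: real and f :: "complex ^ 'n"
  assumes k: "k > 0"
    and finite_S: "finite S" and c_nonneg: "\<And>i. i \<in> S \<Longrightarrow> 0 \<le> c i" and c_sum: "(\<Sum>i\<in>S. c i) = 1"
    and adm: "admissible k W V N F f"
    and admc: "\<And>i. i \<in> S \<Longrightarrow> admissible k (Wc i) (Vc i) (Nc i) (Fc i) (fc i)"
    and W_eq: "W = (\<Sum>i\<in>S. c i *\<^sub>R Wc i)" and V_eq: "V = (\<Sum>i\<in>S. c i *\<^sub>R Vc i)"
    and N_eq: "N = P + (\<Sum>i\<in>S. c i *\<^sub>R Nc i)" and P: "pos_semidef P"
    and F_eq: "F = (\<Sum>i\<in>S. c i * Fc i)" and f_eq: "f = (\<Sum>i\<in>S. c i *\<^sub>R fc i)"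
begin

abbreviation "height \<equiv> bellman_height k W V N"
abbreviation "heightc i \<equiv> bellman_height k (Wc i) (Vc i) (Nc i)"
abbreviation "X \<equiv> bellman_matrix k W V N"
abbreviation "Xc i \<equiv> bellman_matrix k (Wc i) (Vc i) (Nc i)"

lemma pos:
  "pos_def W" "pos_def V" "pos_semidef N" "pos_def (W + N)" "pos_semidef (W - N)"
  "i \<in> S \<Longrightarrow> pos_def (Wc i)" "i \<in> S \<Longrightarrow> pos_def (Vc i)" "i \<in> S \<Longrightarrow> pos_def (Wc i + Nc i)"
  using adm admc by (auto simp: admissible_def intro!: pos_def_add_pos_semidef)

text \<open>Jensen's inequality for a function that lies below its tangent at the barycentre.\<close>

lemma jensen_tangent:
  fixes L :: "'a :: real_inner"
  assumes "\<And>i. i \<in> S \<Longrightarrow> \<phi> i \<le> \<phi>0 + L \<bullet> (y i - y0)"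
  shows "(\<Sum>i\<in>S. c i * \<phi> i) \<le> \<phi>0 + L \<bullet> ((\<Sum>i\<in>S. c i *\<^sub>R y i) - y0)"
proof -
  have "(\<Sum>i\<in>S. c i * \<phi> i) \<le> (\<Sum>i\<in>S. c i * (\<phi>0 + L \<bullet> (y i - y0)))"
    by (intro sum_mono mult_left_mono assms c_nonneg)
  also have "\<dots> = \<phi>0 * (\<Sum>i\<in>S. c i) + L \<bullet> (\<Sum>i\<in>S. c i *\<^sub>R y i) - (L \<bullet> y0) * (\<Sum>i\<in>S. c i)"
    by (simp add: inner_sum_right sum_distrib_left sum_distrib_right sum.distrib sum_subtractf
        algebra_simps inner_diff_right)
  finally show ?thesis
    by (simp add: c_sum inner_diff_right)
qed

lemma height_gain: "(matrix_inv W \<bullet> P) / (4 * k) \<le> height - (\<Sum>i\<in>S. c i * heightc i)"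
proof -
  have "(\<Sum>i\<in>S. c i * ln_det (Wc i + Nc i)) \<le> ln_det (W + N) +
      matrix_inv (W + N) \<bullet> ((\<Sum>i\<in>S. c i *\<^sub>R (Wc i + Nc i)) - (W + N))"
    by (rule jensen_tangent, rule ln_det_tangent) (auto intro: pos)
  also have "(\<Sum>i\<in>S. c i *\<^sub>R (Wc i + Nc i)) - (W + N) = - P"
    by (simp add: W_eq N_eq scaleR_add_right sum.distrib)
  finally have 1: "(\<Sum>i\<in>S. c i * ln_det (Wc i + Nc i)) \<le> ln_det (W + N) - matrix_inv (W + N) \<bullet> P"
    by simp
  have "(\<Sum>i\<in>S. c i * ln_det (Vc i)) \<le> ln_det V +
      matrix_inv V \<bullet> ((\<Sum>i\<in>S. c i *\<^sub>R Vc i) - V)"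
    by (rule jensen_tangent, rule ln_det_tangent) (auto intro: pos)
  then have 2: "(\<Sum>i\<in>S. c i * ln_det (Vc i)) \<le> ln_det V"
    by (simp add: V_eq[symmetric])
  \<comment> \<open>\<open>N \<le> W\<close> gives \<open>W + N \<le> 2 W\<close>, and the inverse is antitone.\<close>
  have "matrix_inv W \<bullet> P / 2 \<le> matrix_inv (W + N) \<bullet> P"
  proof -
    have "(matrix_inv (2 *\<^sub>R W) *v x) \<bullet> x \<le> (matrix_inv (W + N) *v x) \<bullet> x" for x
    proof (rule matrix_inv_antimono)
      show "pos_def (2 *\<^sub>R W)" "pos_def (W + N)"
        using pos by (auto intro: pos_def_scaleR)
      show "((W + N) *v y) \<bullet> y \<le> ((2 *\<^sub>R W) *v y) \<bullet> y" for y
        using pos(5) by (auto simp: pos_semidef_iff matrix_vector_linear inner_add_left inner_diff_left)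
    qed
    moreover have "hermitian (matrix_inv (W + N) - (1 / 2) *\<^sub>R matrix_inv W)"
      using pos_def_matrix_inv[OF pos(4)] pos_def_matrix_inv[OF pos(1)]
      by (intro hermitian_intros) (auto simp: pos_def_iff)
    ultimately have "pos_semidef (matrix_inv (W + N) - (1 / 2) *\<^sub>R matrix_inv W)"
      by (simp add: pos_semidef_iff matrix_inv_scaleR[OF pos(1)] matrix_vector_linear inner_diff_left)
    from inner_pos_semidef_nonneg[OF this P] show ?thesis
      by (simp add: inner_diff_left)
  qed
  with 1 2 have "matrix_inv W \<bullet> P / 2 \<le> ln_det (W + N) + ln_det V
      - (\<Sum>i\<in>S. c i * (ln_det (Wc i + Nc i) + ln_det (Vc i)))"
    by (simp add: distrib_left sum.distrib)
  also have "\<dots> = 2 * k * (height - (\<Sum>i\<in>S. c i * heightc i))"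
  proof -
    have "(\<Sum>i\<in>S. c i * heightc i) = (\<Sum>i\<in>S. c i + c i * (ln_det (Wc i + Nc i) + ln_det (Vc i)) / (2 * k))"
      by (simp add: bellman_height_def distrib_left)
    also have "\<dots> = 1 + (\<Sum>i\<in>S. c i * (ln_det (Wc i + Nc i) + ln_det (Vc i))) / (2 * k)"
      by (simp only: sum.distrib c_sum sum_divide_distrib)
    finally show ?thesis
      using k by (simp add: bellman_height_def right_diff_distrib)
  qed
  finally show ?thesis
    using k by (simp add: field_simps)
qed

lemma matrix_inv_P_nonneg: "0 \<le> matrix_inv W \<bullet> P"
  by (intro inner_pos_semidef_nonneg P pos_def_imp_pos_semidef pos_def_matrix_inv pos)

lemma height_gain_nonneg: "0 \<le> height - (\<Sum>i\<in>S. c i * heightc i)"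
  by (rule order_trans[OF _ height_gain]) (use matrix_inv_P_nonneg k in simp)

text \<open>For fixed \<open>z\<close> and \<open>w = W\<^sup>-\<^sup>1 z\<close>, the form \<open>\<langle>Wc\<^sup>-\<^sup>1 z, z\<rangle>\<close> of a child is at least
\<open>\<langle>W w, w\<rangle>\<^sup>2 / \<langle>Wc w, w\<rangle>\<close>, with equality for the parent. This reduces the convexity of \<open>W\<^sup>-\<^sup>1 / h\<close> to that
of \<open>1 / (a b)\<close> for positive numbers.\<close>

lemma matrix_gain:
  "(\<Sum>i\<in>S. c i * ((Xc i *v z) \<bullet> z)) \<le>
     (X *v z) \<bullet> z - (height - (\<Sum>i\<in>S. c i * heightc i)) / 4 * ((matrix_inv W *v z) \<bullet> z)"
proof (cases "z = 0")
  case True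
  then show ?thesis by (simp add: matrix_vector_linear)
next
  case False
  define w where "w = matrix_inv W *v z"
  define p where "p = (W *v w) \<bullet> w"
  define pc where "pc i = (Wc i *v w) \<bullet> w" for i
  define a where "a = (\<Sum>i\<in>S. c i * heightc i)"
  have Ww: "W *v w = z"
    by (simp add: w_def matrix_inv_vector[OF pos(1)])
  then have w0: "w \<noteq> 0"
    using False by (auto simp: matrix_vector_linear)
  have p: "0 < p" "p = (matrix_inv W *v z) \<bullet> z" "z \<bullet> w = p"
    using pos(1) w0 by (auto simp: p_def pos_def_iff Ww w_def[symmetric] inner_commute)
  have h: "1 \<le> height" "height \<le> 2"
    using bellman_height_bounds[OF adm k] by auto
  have p_sum: "(\<Sum>i\<in>S. c i * pc i) = p"
    by (simp add: p_def pc_def W_eq linear_sum[OF linear_matrix_vector_left] matrix_vector_linear inner_sum_left)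
  have ineq: "p / height * (3 - pc i / p - heightc i / height) \<le> (1 / heightc i) * ((matrix_inv (Wc i) *v z) \<bullet> z)"
    if i: "i \<in> S" for i
  proof -
    have hc: "1 \<le> heightc i"
      using bellman_height_bounds[OF admc[OF i] k] by auto
    have pc: "0 < pc i"
      using pos(6)[OF i] w0 by (auto simp: pc_def pos_def_iff)
    have "p / height * (3 - pc i / p - heightc i / height) \<le>
        p / height * (1 / ((pc i / p) * (heightc i / height)))"
      using p pc h hc by (intro mult_left_mono inverse_product_tangent) auto
    also have "\<dots> = (1 / heightc i) * (p\<^sup>2 / pc i)"
      using p pc h hc by (simp add: field_simps power2_eq_square)
    \<comment> \<open>The multiple \<open>(p / pc i) w\<close> of \<open>w\<close> is the optimal one.\<close>
    also have "p\<^sup>2 / pc i = 2 * (z \<bullet> ((p / pc i) *\<^sub>R w)) - (Wc i *v ((p / pc i) *\<^sub>R w)) \<bullet> ((p / pc i) *\<^sub>R w)"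
      using pc by (simp add: p matrix_vector_linear pc_def[symmetric] power2_eq_square)
    also have "(1 / heightc i) * \<dots> \<le> (1 / heightc i) * ((matrix_inv (Wc i) *v z) \<bullet> z)"
      using hc by (intro mult_left_mono matrix_inv_inner_ge pos(6)[OF i]) auto
    finally show ?thesis .
  qed
  have "(1 / height) * p + (height - a) / 4 * p \<le> p / height * (3 - 1 - a / height)"
  proof -
    \<comment> \<open>Here the upper bound on the height enters and yields the factor \<open>1/4\<close>.\<close>
    have "height * height \<le> 2 * 2"
      using h by (intro mult_mono) auto
    then have "(height - a) / 4 \<le> (height - a) / (height * height)"
      using height_gain_nonneg h by (intro divide_left_mono) (auto simp: a_def)
    then have "(height - a) / 4 * p \<le> (height - a) / (height * height) * p"
      using p by (intro mult_right_mono) auto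
    also have "\<dots> = p / height * (3 - 1 - a / height) - (1 / height) * p"
      using h by (simp add: field_simps)
    finally show ?thesis by linarith
  qed
  also have "p / height * (3 - 1 - a / height) = (\<Sum>i\<in>S. c i * (p / height * (3 - pc i / p - heightc i / height)))"
  proof -
    have "(\<Sum>i\<in>S. c i * (p / height * (3 - pc i / p - heightc i / height)))
        = p / height * (\<Sum>i\<in>S. 3 * c i - (c i * pc i) / p - (c i * heightc i) / height)"
      using p(1) by (simp add: sum_distrib_left algebra_simps)
    also have "(\<Sum>i\<in>S. 3 * c i - (c i * pc i) / p - (c i * heightc i) / height)
       = 3 * (\<Sum>i\<in>S. c i) - (\<Sum>i\<in>S. c i * pc i) / p - a / height"
      by (simp add: sum_subtractf sum_divide_distrib[symmetric] sum_distrib_left[symmetric] a_def)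
    finally show ?thesis
      using p by (simp add: c_sum p_sum)
  qed
  also have "\<dots> \<le> (\<Sum>i\<in>S. c i * ((1 / heightc i) * ((matrix_inv (Wc i) *v z) \<bullet> z)))"
    by (intro sum_mono mult_left_mono ineq c_nonneg)
  finally have main: "(1 / height) * p + (height - a) / 4 * p \<le>
    (\<Sum>i\<in>S. c i * ((1 / heightc i) * ((matrix_inv (Wc i) *v z) \<bullet> z)))" .
  have "(V *v z) \<bullet> z = (\<Sum>i\<in>S. c i * ((Vc i *v z) \<bullet> z))"
    by (simp add: V_eq linear_sum[OF linear_matrix_vector_left] matrix_vector_linear inner_sum_left)
  moreover have "(\<Sum>i\<in>S. c i * ((Xc i *v z) \<bullet> z)) = 2 * (\<Sum>i\<in>S. c i * ((Vc i *v z) \<bullet> z))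
      - (\<Sum>i\<in>S. c i * ((1 / heightc i) * ((matrix_inv (Wc i) *v z) \<bullet> z)))"
    by (simp add: bellman_matrix_def matrix_vector_linear inner_diff_left sum_subtractf sum_distrib_left algebra_simps)
  moreover have "(X *v z) \<bullet> z = 2 * ((V *v z) \<bullet> z) - (1 / height) * p"
    by (simp add: bellman_matrix_def matrix_vector_linear inner_diff_left p(2))
  ultimately show ?thesis
    using main by (simp add: a_def p(2)[symmetric])
qed

text \<open>With \<open>z = X\<^sup>-\<^sup>1 f\<close>, convexity of \<open>\<langle>X\<^sup>-\<^sup>1 f, f\<rangle>\<close> makes the gain at least the gain of \<open>\<langle>X z, z\<rangle>\<close>,
which is \<open>\<delta>/4 \<langle>W\<^sup>-\<^sup>1 z, z\<rangle>\<close> for the gain \<open>\<delta>\<close> in height. The chain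
\<open>\<langle>W f, f\<rangle> \<le> k \<langle>V\<^sup>-\<^sup>1 f, f\<rangle> \<le> 2 k \<langle>X z, z\<rangle> \<le> 4 k \<langle>V z, z\<rangle> \<le> 4 k\<^sup>2 \<langle>W\<^sup>-\<^sup>1 z, z\<rangle>\<close> returns from \<open>z\<close> to
\<open>f\<close>, and \<open>\<langle>P f, f\<rangle> \<le> (W\<^sup>-\<^sup>1 \<bullet> P) \<langle>W f, f\<rangle>\<close> with \<open>W\<^sup>-\<^sup>1 \<bullet> P \<le> 4 k \<delta>\<close> closes the estimate.\<close>

theorem bellman_gain:
  "(\<Sum>i\<in>S. c i * bellman k (Wc i) (Vc i) (Nc i) (Fc i) (fc i)) + ((P *v f) \<bullet> f) / (64 * k ^ 3)
     \<le> bellman k W V N F f"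
proof -
  define z where "z = matrix_inv X *v f"
  define \<delta> where "\<delta> = height - (\<Sum>i\<in>S. c i * heightc i)"
  have X: "pos_def X" by (rule bellman_matrix_bounds(3)[OF adm k])
  have Xz: "X *v z = f"
    by (simp add: z_def matrix_inv_vector[OF X])
  have zf: "(matrix_inv X *v f) \<bullet> f = (X *v z) \<bullet> z"
    by (simp add: Xz z_def[symmetric] inner_commute)
  have \<delta>: "0 \<le> \<delta>" "(matrix_inv W \<bullet> P) / (4 * k) \<le> \<delta>"
    unfolding \<delta>_def using height_gain_nonneg height_gain by auto
  have WV: "W \<bullet> V \<le> k"
    using adm by (simp add: admissible_def)
  have decr: "(X *v z) \<bullet> z + \<delta> / 4 * ((matrix_inv W *v z) \<bullet> z) \<le>
      (\<Sum>i\<in>S. c i * ((matrix_inv (Xc i) *v fc i) \<bullet> fc i))"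
  proof -
    have "2 * (f \<bullet> z) - ((X *v z) \<bullet> z - \<delta> / 4 * ((matrix_inv W *v z) \<bullet> z))
        \<le> 2 * (f \<bullet> z) - (\<Sum>i\<in>S. c i * ((Xc i *v z) \<bullet> z))"
      using matrix_gain[of z] by (simp add: \<delta>_def)
    also have "\<dots> = (\<Sum>i\<in>S. c i * (2 * (fc i \<bullet> z) - (Xc i *v z) \<bullet> z))"
      by (simp add: f_eq inner_sum_left sum_distrib_left sum_subtractf algebra_simps)
    also have "\<dots> \<le> (\<Sum>i\<in>S. c i * ((matrix_inv (Xc i) *v fc i) \<bullet> fc i))"
      by (intro sum_mono mult_left_mono matrix_inv_inner_ge c_nonneg bellman_matrix_bounds(3)[OF admc k])
    finally show ?thesis
      by (simp add: Xz)
  qed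
  have W': "pos_def (matrix_inv W)" and V': "pos_def (matrix_inv V)"
    by (intro pos_def_matrix_inv pos)+
  have nn: "0 \<le> (W *v f) \<bullet> f" "0 \<le> (matrix_inv W *v z) \<bullet> z" "0 \<le> (matrix_inv V *v f) \<bullet> f"
    using W' V' pos(1) pos_def_imp_pos_semidef pos_semidef_iff by blast+
  have step1: "(V *v z) \<bullet> z \<le> k * ((matrix_inv W *v z) \<bullet> z)"
    using quadratic_form_le_inner[OF W' pos_def_imp_pos_semidef[OF pos(2)], of z]
      mult_right_mono[OF WV nn(2)] by (simp add: matrix_inv_matrix_inv[OF pos(1)])
  have step2: "(X *v z) \<bullet> z \<le> 2 * ((V *v z) \<bullet> z)"
    by (rule bellman_matrix_bounds(2)[OF adm k])
  have step3: "(matrix_inv V *v f) \<bullet> f \<le> 2 * ((X *v z) \<bullet> z)"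
  proof -
    have "(matrix_inv (2 *\<^sub>R V) *v f) \<bullet> f \<le> (matrix_inv X *v f) \<bullet> f"
      using bellman_matrix_bounds(2)[OF adm k]
      by (intro matrix_inv_antimono[OF X]) (auto intro: pos_def_scaleR pos simp: matrix_vector_linear)
    then show ?thesis
      by (simp add: matrix_inv_scaleR[OF pos(2)] matrix_vector_linear zf)
  qed
  have step4: "(W *v f) \<bullet> f \<le> k * ((matrix_inv V *v f) \<bullet> f)"
    using quadratic_form_le_inner[OF V' pos_def_imp_pos_semidef[OF pos(1)], of f]
      mult_right_mono[OF WV nn(3)] by (simp add: matrix_inv_matrix_inv[OF pos(2)] inner_commute)
  have step5: "(P *v f) \<bullet> f \<le> (matrix_inv W \<bullet> P) * ((W *v f) \<bullet> f)"
    by (rule quadratic_form_le_inner[OF pos(1) P])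
  have "(W *v f) \<bullet> f \<le> k * (4 * (k * ((matrix_inv W *v z) \<bullet> z)))"
    using step1 step2 step3 by (intro order_trans[OF step4] mult_left_mono) (use k in auto)
  then have wz: "(W *v f) \<bullet> f \<le> 4 * k\<^sup>2 * ((matrix_inv W *v z) \<bullet> z)"
    by (simp add: power2_eq_square)
  have "(P *v f) \<bullet> f \<le> (4 * k * \<delta>) * (4 * k\<^sup>2 * ((matrix_inv W *v z) \<bullet> z))"
    by (rule order_trans[OF step5], rule mult_mono)
       (use \<delta> k nn wz matrix_inv_P_nonneg in \<open>auto simp: field_simps\<close>)
  also have "\<dots> = (64 * k ^ 3) * (\<delta> / 4 * ((matrix_inv W *v z) \<bullet> z))"
    by (simp add: power2_eq_square power3_eq_cube)
  finally have "((P *v f) \<bullet> f) / (64 * k ^ 3) \<le> \<delta> / 4 * ((matrix_inv W *v z) \<bullet> z)"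
    using k by (simp add: divide_le_eq ac_simps)
  with decr have "(X *v z) \<bullet> z + ((P *v f) \<bullet> f) / (64 * k ^ 3) \<le>
      (\<Sum>i\<in>S. c i * ((matrix_inv (Xc i) *v fc i) \<bullet> fc i))"
    by linarith
  then show ?thesis
    by (simp add: bellman_def zf right_diff_distrib sum_subtractf F_eq)
qed

end

section \<open>Telescoping over a dyadic grid\<close>

text \<open>A half-open cube differs from the closed one by part of the boundary, a null set. This is what relates
the cubes of a grid to the closed cubes of the \<open>A\<^sub>2\<close> characteristic.\<close>

lemma half_open_cube_measure:
  fixes a :: "real ^ 'd"
  assumes l: "0 < l"
  shows "half_open_cube a l \<in> lmeasurable" "measure lebesgue (half_open_cube a l) = l ^ CARD('d)"
    "half_open_cube a l \<subseteq> cube a l" "cube a l \<in> lmeasurable" "measure lebesgue (cube a l) = l ^ CARD('d)"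
proof -
  define b where "b = a + (\<chi> i. l)"
  have cube: "cube a l = cbox a b"
    by (auto simp: cube_def b_def mem_box_cart)
  have sub: "box a b \<subseteq> half_open_cube a l" "half_open_cube a l \<subseteq> cbox a b"
    by (auto simp: half_open_cube_def b_def mem_box_cart less_imp_le)
  show "half_open_cube a l \<subseteq> cube a l"
    using sub cube by simp
  show "cube a l \<in> lmeasurable"
    by (simp add: cube)
  have "a \<in> cbox a b"
    using l by (simp add: b_def mem_box_cart)
  then have ne: "cbox a b \<noteq> {}" by blast
  show cm: "measure lebesgue (cube a l) = l ^ CARD('d)"
    by (simp add: cube content_cbox_cart[OF ne]) (simp add: b_def)
  have negl: "negligible (cbox a b - half_open_cube a l \<union> (half_open_cube a l - cbox a b))"
    by (rule negligible_subset[OF negligible_frontier_interval[of a b]]) (use sub in auto)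
  show "half_open_cube a l \<in> lmeasurable"
    by (rule lmeasurable_negligible_symdiff[OF _ negl]) simp
  show "measure lebesgue (half_open_cube a l) = l ^ CARD('d)"
    using measure_negligible_symdiff[OF _ negl] cm by (simp add: cube)
qed

definition grid_level :: "(real ^ 'd) set set \<Rightarrow> int \<Rightarrow> (real ^ 'd) set set" where
  "grid_level D k = {I \<in> D. \<exists>a. I = half_open_cube a (2 powi k)}"

definition grid_below :: "(real ^ 'd) set set \<Rightarrow> int \<Rightarrow> (real ^ 'd) set \<Rightarrow> (real ^ 'd) set set" where
  "grid_below D k J = {I \<in> grid_level D k. I \<subseteq> J}"

context
  fixes D :: "(real ^ 'd) set set"
  assumes D: "dyadic_grid D"
begin

lemma grid_axioms:
  "\<forall>I\<in>D. \<exists>a (k::int). I = half_open_cube a (2 powi k)"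
  "\<forall>I\<in>D. \<forall>J\<in>D. I \<subseteq> J \<or> J \<subseteq> I \<or> I \<inter> J = {}"
  "\<forall>k. partition_on UNIV (grid_level D k)"
  using D unfolding dyadic_grid_def grid_level_def by simp_all

lemma grid_has_level: "I \<in> D \<Longrightarrow> \<exists>k. I \<in> grid_level D k"
  using grid_axioms(1) unfolding grid_level_def by blast

lemma grid_levelD: "I \<in> grid_level D k \<Longrightarrow> I \<in> D"
  by (simp add: grid_level_def)

lemma grid_level_measure:
  assumes "I \<in> grid_level D k"
  shows "I \<in> lmeasurable" "measure lebesgue I = (2 powi k) ^ CARD('d)" "0 < measure lebesgue I"
proof -
  obtain a where "I = half_open_cube a (2 powi k)"
    using assms by (auto simp: grid_level_def)
  then show "I \<in> lmeasurable" "measure lebesgue I = (2 powi k) ^ CARD('d)" "0 < measure lebesgue I"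
    using half_open_cube_measure(1,2)[of "2 powi k" a] by simp_all
qed

lemma grid_level_partition: "partition_on UNIV (grid_level D k)"
  using grid_axioms(3) by blast

lemma grid_level_disjoint:
  "I \<in> grid_level D k \<Longrightarrow> J \<in> grid_level D k \<Longrightarrow> I \<inter> J \<noteq> {} \<Longrightarrow> I = J"
  using grid_level_partition[of k] unfolding partition_on_def disjoint_def by blast

lemma grid_level_cover: "\<exists>I\<in>grid_level D k. x \<in> I"
  using grid_level_partition[of k] unfolding partition_on_def by blast

lemma grid_level_nonempty: "I \<in> grid_level D k \<Longrightarrow> I \<noteq> {}"
  using grid_level_partition[of k] unfolding partition_on_def by blast

text \<open>Comparing volumes, since a cube determines its side length through its measure.\<close>

lemma grid_subset_imp_level_le:
  assumes "I \<in> grid_level D j" "J \<in> grid_level D k" "I \<subseteq> J"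
  shows "j \<le> k"
proof -
  have "measure lebesgue I \<le> measure lebesgue J"
    by (intro measure_mono_fmeasurable assms grid_level_measure[OF assms(2)] fmeasurableD grid_level_measure[OF assms(1)])
  then have "((2::real) powi j) ^ CARD('d) \<le> (2 powi k) ^ CARD('d)"
    using grid_level_measure[OF assms(1)] grid_level_measure[OF assms(2)] by simp
  then have "(2::real) powi j \<le> 2 powi k"
    by (subst (asm) power_mono_iff) auto
  then show ?thesis
    using power_int_strict_increasing[of k j "2 :: real"] by force
qed

lemma grid_nested:
  assumes "I \<in> grid_level D j" "J \<in> grid_level D k" "j \<le> k" "I \<inter> J \<noteq> {}"
  shows "I \<subseteq> J"
proof -
  have "I \<subseteq> J \<or> J \<subseteq> I"
    using grid_axioms(2) assms grid_levelD by blast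
  then show ?thesis
    using grid_subset_imp_level_le[OF assms(2,1)] grid_level_disjoint[of I j J] assms by auto
qed

lemma grid_below_Union:
  assumes "J \<in> grid_level D k" "j \<le> k"
  shows "\<Union> (grid_below D j J) = J"
proof
  show "J \<subseteq> \<Union> (grid_below D j J)"
  proof
    fix x assume x: "x \<in> J"
    obtain I where "I \<in> grid_level D j" "x \<in> I"
      using grid_level_cover by blast
    with grid_nested[of I j J k] x assms show "x \<in> \<Union> (grid_below D j J)"
      by (auto simp: grid_below_def)
  qed
qed (auto simp: grid_below_def)

lemma grid_below_disjoint: "disjoint (grid_below D j J)"
  unfolding disjoint_def grid_below_def using grid_level_disjoint by blast

text \<open>The cubes of one level inside \<open>J\<close> are disjoint and have equal positive measure, so at most
\<open>|J|\<close> divided by that measure of them fit.\<close>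

lemma finite_grid_below:
  assumes J: "J \<in> grid_level D k"
  shows "finite (grid_below D j J)"
proof -
  define m where "m = ((2::real) powi j) ^ CARD('d)"
  have m: "0 < m" by (simp add: m_def)
  have "card G \<le> nat \<lceil>measure lebesgue J / m\<rceil>" if G: "G \<subseteq> grid_below D j J" "finite G" for G
  proof -
    have I: "I \<in> grid_level D j" if "I \<in> G" for I
      using that G by (auto simp: grid_below_def)
    have "real (card G) * m = (\<Sum>I\<in>G. measure lebesgue I)"
      using grid_level_measure(2)[OF I] by (simp add: m_def)
    also have "\<dots> = measure lebesgue (\<Union>I\<in>G. I)"
    proof (rule measure_finite_Union[symmetric])
      show "disjoint_family_on (\<lambda>I. I) G"
        using grid_below_disjoint G(1) unfolding disjoint_def disjoint_family_on_def by blast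
    qed (use G(2) fmeasurableD[OF grid_level_measure(1)[OF I]] fmeasurableD2[OF grid_level_measure(1)[OF I]]
        in auto)
    also have "\<dots> \<le> measure lebesgue J"
      using G grid_level_measure(1)[OF I] 
      by (intro measure_mono_fmeasurable grid_level_measure[OF J]) (auto simp: grid_below_def intro!: sets.finite_UN)
    finally have "real (card G) \<le> measure lebesgue J / m"
      using m by (simp add: field_simps)
    then show ?thesis
      by linarith
  qed
  then show ?thesis
    using finite_if_finite_subsets_card_bdd by blast
qed

lemma grid_below_one_step:
  assumes J: "J \<in> grid_level D (k + 1)" and I: "I \<in> D" "I \<subseteq> J" "I \<noteq> J"
  shows "\<exists>K\<in>grid_below D k J. I \<subseteq> K"
proof -
  obtain j where j: "I \<in> grid_level D j"
    using grid_has_level[OF I(1)] by blast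
  have "j \<le> k + 1"
    by (rule grid_subset_imp_level_le[OF j J I(2)])
  moreover have "j \<noteq> k + 1"
    using grid_level_disjoint[of I j J] grid_level_nonempty[OF j] I j J by blast
  ultimately have jk: "j \<le> k" by linarith
  obtain x where x: "x \<in> I"
    using grid_level_nonempty[OF j] by blast
  obtain K where K: "K \<in> grid_level D k" "x \<in> K"
    using grid_level_cover by blast
  have "I \<subseteq> K" "K \<subseteq> J"
    using grid_nested[OF j K(1) jk] grid_nested[OF K(1) J] x K I by auto
  with K show ?thesis
    by (auto simp: grid_below_def)
qed

lemma sum_grid_below:
  fixes g :: "(real ^ 'd) set \<Rightarrow> 'a :: comm_monoid_add"
  assumes J: "J \<in> grid_level D (k + 1)" and S: "finite S" "S \<subseteq> D"
  shows "(\<Sum>I\<in>{I \<in> S. I \<subseteq> J}. g I) =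
    (if J \<in> S then g J else 0) + (\<Sum>K\<in>grid_below D k J. \<Sum>I\<in>{I \<in> S. I \<subseteq> K}. g I)"
proof -
  define C where "C = grid_below D k J"
  have C: "K \<in> grid_level D k" "K \<subseteq> J" "K \<noteq> J" if "K \<in> C" for K
  proof -
    show K: "K \<in> grid_level D k" "K \<subseteq> J"
      using that by (auto simp: C_def grid_below_def)
    show "K \<noteq> J"
      using grid_subset_imp_level_le[OF J K(1)] by auto
  qed
  have finC: "finite C"
    unfolding C_def by (rule finite_grid_below[OF J])
  have below: "\<exists>K\<in>C. I \<subseteq> K" if "I \<in> S" "I \<subseteq> J" "I \<noteq> J" for I
    using grid_below_one_step[OF J] S(2) that unfolding C_def by blast
  have split: "{I \<in> S. I \<subseteq> J} = (if J \<in> S then {J} else {}) \<union> (\<Union>K\<in>C. {I \<in> S. I \<subseteq> K})"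
    (is "?L = ?R")
  proof
    show "?L \<subseteq> ?R"
    proof
      fix I assume I: "I \<in> ?L"
      show "I \<in> ?R"
        using below[of I] I by (cases "I = J") auto
    qed
    show "?R \<subseteq> ?L"
      using C(2) by (cases "J \<in> S") auto
  qed
  have notJ: "\<not> J \<subseteq> K" if "K \<in> C" for K
    using C[OF that] by blast
  have "(\<Sum>I\<in>{I \<in> S. I \<subseteq> J}. g I)
      = (if J \<in> S then g J else 0) + (\<Sum>I\<in>(\<Union>K\<in>C. {I \<in> S. I \<subseteq> K}). g I)"
    unfolding split using S(1) finC notJ by (subst sum.union_disjoint) auto
  also have "(\<Sum>I\<in>(\<Union>K\<in>C. {I \<in> S. I \<subseteq> K}). g I) = (\<Sum>K\<in>C. \<Sum>I\<in>{I \<in> S. I \<subseteq> K}. g I)"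
  proof (rule sum.UNION_disjoint[OF finC])
    show "\<forall>K\<in>C. \<forall>L\<in>C. K \<noteq> L \<longrightarrow> {I \<in> S. I \<subseteq> K} \<inter> {I \<in> S. I \<subseteq> L} = {}"
    proof (intro ballI impI)
      fix K L assume KL: "K \<in> C" "L \<in> C" "K \<noteq> L"
      then have "K \<inter> L = {}"
        using grid_level_disjoint C(1) by blast
      moreover have "I \<noteq> {}" if "I \<in> S" for I
        using that S(2) grid_has_level grid_level_nonempty by blast
      ultimately show "{I \<in> S. I \<subseteq> K} \<inter> {I \<in> S. I \<subseteq> L} = {}"
        by blast
    qed
  qed (use S(1) in auto)
  finally show ?thesis
    by (simp add: C_def)
qed

text \<open>A potential \<open>B\<close> whose excess over the sum of its values at the children of \<open>J\<close> is at least \<open>b J\<close> when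
\<open>J\<close> belongs to \<open>S\<close> dominates the sum of \<open>b\<close> over \<open>S\<close> below \<open>J\<close>, by induction on levels from a
level below all cubes in \<open>S\<close>. The cubes in \<open>S\<close> need not have a common ancestor, as with the quadrants
of the standard grid; hence the set \<open>T\<close> of disjoint top cubes.\<close>

lemma grid_telescoping:
  fixes b B :: "(real ^ 'd) set \<Rightarrow> real"
  assumes S: "finite S" "S \<subseteq> D"
    and nonneg: "\<And>J. J \<in> D \<Longrightarrow> 0 \<le> B J"
    and step: "\<And>k J. J \<in> grid_level D (k + 1) \<Longrightarrow>
      (\<Sum>K\<in>grid_below D k J. B K) + (if J \<in> S then b J else 0) \<le> B J"
  obtains T where "finite T" "T \<subseteq> D" "disjoint T" "(\<Sum>I\<in>S. b I) \<le> (\<Sum>J\<in>T. B J)"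
proof -
  obtain lev where lev: "\<And>I. I \<in> S \<Longrightarrow> I \<in> grid_level D (lev I)"
    using grid_has_level S(2) by (metis subsetD)
  \<comment> \<open>Inserting \<open>0\<close> makes the extrema meaningful for empty \<open>S\<close>.\<close>
  define lo where "lo = Min (insert 0 (lev ` S)) - 1"
  define hi where "hi = Max (insert 0 (lev ` S))"
  have lo: "lo < lev I" and hi: "lev I \<le> hi" if "I \<in> S" for I
  proof -
    have "Min (insert 0 (lev ` S)) \<le> lev I"
      using S that by (intro Min_le) auto
    then show "lo < lev I" by (simp add: lo_def)
    show "lev I \<le> hi"
      using S that unfolding hi_def by (intro Max_ge) auto
  qed
  have "Min (insert 0 (lev ` S)) \<le> 0" "0 \<le> Max (insert 0 (lev ` S))"
    using S by (auto intro: Min_le Max_ge)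
  then have lohi: "lo \<le> hi"
    by (simp add: lo_def hi_def)
  have main: "\<forall>J\<in>grid_level D k. (\<Sum>I\<in>{I \<in> S. I \<subseteq> J}. b I) \<le> B J" if "lo \<le> k" for k
    using that
  proof (induction k rule: int_ge_induct)
    case base
    have "{I \<in> S. I \<subseteq> J} = {}" if "J \<in> grid_level D lo" for J
      using grid_subset_imp_level_le[OF lev that] lo by force
    then show ?case
      using nonneg grid_levelD by (metis sum.empty)
  next
    case (step k)
    show ?case
    proof
      fix J assume J: "J \<in> grid_level D (k + 1)"
      have "(\<Sum>I\<in>{I \<in> S. I \<subseteq> J}. b I) \<le> (if J \<in> S then b J else 0) + (\<Sum>K\<in>grid_below D k J. B K)"
        unfolding sum_grid_below[OF J S] using step.IH
        by (intro add_left_mono sum_mono) (auto simp: grid_below_def)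
      also have "\<dots> \<le> B J"
        using assms(4)[OF J] by simp
      finally show "(\<Sum>I\<in>{I \<in> S. I \<subseteq> J}. b I) \<le> B J" .
    qed
  qed
  define top where "top I = (SOME J. J \<in> grid_level D hi \<and> I \<subseteq> J)" for I
  have top: "top I \<in> grid_level D hi" "I \<subseteq> top I" if I: "I \<in> S" for I
  proof -
    obtain x where x: "x \<in> I"
      using grid_level_nonempty[OF lev[OF I]] by blast
    obtain J where J: "J \<in> grid_level D hi" "x \<in> J"
      using grid_level_cover by blast
    have "I \<subseteq> J"
      using grid_nested[OF lev[OF I] J(1) hi[OF I]] x J by blast
    with J have "\<exists>J. J \<in> grid_level D hi \<and> I \<subseteq> J" by blast
    then have "top I \<in> grid_level D hi \<and> I \<subseteq> top I"
      unfolding top_def by (rule someI_ex)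
    then show "top I \<in> grid_level D hi" "I \<subseteq> top I" by auto
  qed
  have top_eq: "I \<subseteq> J \<longleftrightarrow> top I = J" if "I \<in> S" "J \<in> top ` S" for I J
  proof
    assume "I \<subseteq> J"
    then have "top I \<inter> J \<noteq> {}"
      using top(2)[OF that(1)] grid_level_nonempty[OF lev[OF that(1)]] by blast
    then show "top I = J"
      using grid_level_disjoint top that by blast
  qed (use top that in auto)
  show thesis
  proof
    show "finite (top ` S)" using S by simp
    show "top ` S \<subseteq> D" using top grid_levelD by blast
    show "disjoint (top ` S)"
      unfolding disjoint_def using grid_level_disjoint top by blast
    have "(\<Sum>I\<in>S. b I) = (\<Sum>J\<in>top ` S. \<Sum>I\<in>{I \<in> S. top I = J}. b I)"
      using S by (intro sum.image_gen)
    also have "\<dots> = (\<Sum>J\<in>top ` S. \<Sum>I\<in>{I \<in> S. I \<subseteq> J}. b I)"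
      using top_eq by (intro sum.cong refl) auto
    also have "\<dots> \<le> (\<Sum>J\<in>top ` S. B J)"
      using main[OF lohi] top by (intro sum_mono) auto
    finally show "(\<Sum>I\<in>S. b I) \<le> (\<Sum>J\<in>top ` S. B J)" .
  qed
qed

end

section \<open>Traces, norms and measurability of the inverse\<close>

lemma continuous_on_det:
  fixes f :: "'a :: topological_space \<Rightarrow> complex ^ 'n ^ 'n"
  assumes "continuous_on S f"
  shows "continuous_on S (\<lambda>x. det (f x))"
  unfolding det_def using assms by (intro continuous_intros)

text \<open>By Cramer's rule the inverse is continuous on the open set of invertible matrices. On its complement
\<open>matrix_inv\<close> chooses from the empty set, so it is constant there.\<close>

lemma measurable_matrix_inv: "(matrix_inv :: complex ^ 'n ^ 'n \<Rightarrow> _) \<in> borel_measurable borel"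
proof -
  define cof :: "complex ^ 'n ^ 'n \<Rightarrow> 'n \<Rightarrow> 'n \<Rightarrow> complex ^ 'n ^ 'n"
    where "cof A i j = (\<chi> r s. if s = i then axis j 1 $ r else A $ r $ s)" for A i j
  have inv: "matrix_inv A = (\<chi> i j. det (cof A i j) / det A)" if "det A \<noteq> 0" for A :: "complex ^ 'n ^ 'n"
  proof -
    have "matrix_inv A $ i $ j = det (cof A i j) / det A" for i j
    proof -
      have "A *v (matrix_inv A *v axis j 1) = axis j 1"
        using that by (simp add: matrix_vector_mul_assoc matrix_inv_mult invertible_det_nz)
      then show ?thesis
        unfolding cramer[OF that] cof_def matrix_vector_axis[symmetric] by (simp add: vec_eq_iff)
    qed
    then show ?thesis by (simp add: vec_eq_iff)
  qed
  have noninv: "matrix_inv A = matrix_inv 0" if "det A = 0" for A :: "complex ^ 'n ^ 'n"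
  proof -
    have "\<not> invertible A" "\<not> invertible (0 :: complex ^ 'n ^ 'n)"
      using that det_0[where 'a=complex and 'n='n] by (simp_all add: invertible_det_nz mat_0)
    then have "(\<lambda>A'. A ** A' = mat 1 \<and> A' ** A = mat 1) = (\<lambda>A'. 0 ** A' = mat 1 \<and> A' ** 0 = mat 1)"
      by (auto simp: invertible_def fun_eq_iff)
    then show ?thesis
      by (simp only: matrix_inv_def)
  qed
  have cof: "continuous_on X (\<lambda>A. det (cof A i j))" for X i j
  proof -
    have "continuous_on X (\<lambda>A :: complex ^ 'n ^ 'n. if s = i then c else A $ r $ s)" for s r c
      by (cases "s = i") (auto intro!: continuous_intros)
    then show ?thesis
      unfolding cof_def by (intro continuous_on_det continuous_on_vec_lambda)
  qed
  have "closed {A :: complex ^ 'n ^ 'n. det A = 0}"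
    by (intro closed_Collect_eq continuous_on_det continuous_intros)
  then have "(\<lambda>A :: complex ^ 'n ^ 'n. if A \<in> {A. det A = 0} then matrix_inv 0 else (\<chi> i j. det (cof A i j) / det A))
      \<in> borel_measurable borel"
    by (intro borel_measurable_continuous_on_if continuous_on_vec_lambda continuous_on_divide
        continuous_on_det cof continuous_intros) auto
  moreover have "(\<lambda>A :: complex ^ 'n ^ 'n. if A \<in> {A. det A = 0} then matrix_inv 0 else (\<chi> i j. det (cof A i j) / det A))
      = matrix_inv"
    using inv noninv by (auto simp: fun_eq_iff)
  ultimately show ?thesis by simp
qed

text \<open>\<open>A \<le> (trace A) 1\<close> by \<open>quadratic_form_le_inner\<close>; pairing this with \<open>A\<close> gives
\<open>|A|\<^sup>2 \<le> (trace A)\<^sup>2\<close>. Integrability of a positive matrix function thus reduces to that of its trace.\<close>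

lemma pos_semidef_norm_le_trace:
  fixes A :: "complex ^ 'n ^ 'n"
  assumes "pos_semidef A"
  shows "norm A \<le> mat 1 \<bullet> A"
proof -
  have 1: "pos_def (mat 1 :: complex ^ 'n ^ 'n)"
    by (auto simp: pos_def_iff hermitian_intros)
  have "matrix_inv (mat 1) = (mat 1 :: complex ^ 'n ^ 'n)"
    by (rule matrix_inv_unique) simp
  then have "(A *v x) \<bullet> x \<le> (mat 1 \<bullet> A) * (x \<bullet> x)" for x
    using quadratic_form_le_inner[OF 1 assms, of x] by simp
  then have "pos_semidef ((mat 1 \<bullet> A) *\<^sub>R mat 1 - A)"
    using assms by (auto simp: pos_semidef_iff matrix_vector_linear inner_diff_left intro!: hermitian_intros)
  then have "0 \<le> ((mat 1 \<bullet> A) *\<^sub>R mat 1 - A) \<bullet> A"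
    by (rule inner_pos_semidef_nonneg[OF _ assms])
  then have "(norm A)\<^sup>2 \<le> (mat 1 \<bullet> A)\<^sup>2"
    unfolding power2_norm_eq_inner by (simp add: inner_diff_left power2_eq_square)
  then show ?thesis
    using inner_pos_semidef_nonneg[OF pos_semidef_intros(3) assms] by (rule power2_le_imp_le)
qed

text \<open>The reciprocal of \<open>trace A\<^sup>-\<^sup>1\<close> is an explicit lower bound for the spectrum of \<open>A\<close>.\<close>

lemma pos_def_inner_lower_bound:
  fixes A :: "complex ^ 'n ^ 'n"
  assumes A: "pos_def A"
  obtains r where "0 < r" "\<And>B. pos_semidef B \<Longrightarrow> r * (mat 1 \<bullet> B) \<le> A \<bullet> B"
proof -
  define m where "m = matrix_inv A \<bullet> mat 1"
  have le: "x \<bullet> x \<le> m * ((A *v x) \<bullet> x)" for x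
    using quadratic_form_le_inner[OF A pos_semidef_intros(3), of x] by (simp add: m_def)
  have m: "0 < m"
  proof -
    have "axis i 1 \<noteq> (0 :: complex ^ 'n)" for i
      by simp
    then obtain x :: "complex ^ 'n" where "x \<noteq> 0"
      by blast
    then have "0 < x \<bullet> x" "0 < (A *v x) \<bullet> x"
      using A by (auto simp: pos_def_iff)
    then show ?thesis
      using le[of x] by (meson less_le_trans zero_less_mult_pos2)
  qed
  have psd: "pos_semidef (A - (1 / m) *\<^sub>R mat 1)"
    using le m A by (auto simp: pos_semidef_iff pos_def_iff matrix_vector_linear inner_diff_left field_simps
        intro!: hermitian_intros)
  show thesis
  proof
    show "0 < 1 / m" using m by simp
    fix B :: "complex ^ 'n ^ 'n" assume "pos_semidef B"
    from inner_pos_semidef_nonneg[OF psd this] show "1 / m * (mat 1 \<bullet> B) \<le> A \<bullet> B"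
      by (simp add: inner_diff_left)
  qed
qed

lemma inner_pos_def_pos:
  fixes A B :: "complex ^ 'n ^ 'n"
  assumes "pos_def A" "pos_def B"
  shows "0 < A \<bullet> B"
proof -
  have "axis i 1 \<noteq> (0 :: complex ^ 'n)" for i
    by simp
  then obtain x :: "complex ^ 'n" where "x \<noteq> 0"
    by blast
  then have 1: "0 < (B *v x) \<bullet> x" "0 < (matrix_inv A *v x) \<bullet> x"
    using assms pos_def_matrix_inv by (auto simp: pos_def_iff)
  moreover have "(B *v x) \<bullet> x \<le> (A \<bullet> B) * ((matrix_inv A *v x) \<bullet> x)"
    using quadratic_form_le_inner[OF pos_def_matrix_inv[OF assms(1)] pos_def_imp_pos_semidef[OF assms(2)], of x]
    by (simp add: matrix_inv_matrix_inv[OF assms(1)])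
  ultimately show ?thesis
    by (meson less_le_trans zero_less_mult_pos2)
qed

text \<open>The squared Frobenius norm of \<open>A\<^sup>1\<^sup>/\<^sup>2 B\<^sup>-\<^sup>1\<^sup>/\<^sup>2\<close> is \<open>A \<bullet> B\<^sup>-\<^sup>1\<close>, and each of its \<open>n\<close> columns is bounded
by the operator norm.\<close>

lemma inner_le_op_norm:
  fixes A B :: "complex ^ 'n ^ 'n"
  assumes A: "pos_def A" and B: "pos_def B"
  shows "A \<bullet> matrix_inv B \<le> CARD('n) * (op_norm (mat_sqrt A ** matrix_inv (mat_sqrt B)))\<^sup>2"
proof -
  define T where "T = mat_sqrt A ** matrix_inv (mat_sqrt B)"
  have psd: "pos_semidef A" "pos_semidef B" "pos_semidef (matrix_inv B)"
    using A B by (auto intro: pos_def_imp_pos_semidef pos_def_matrix_inv)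
  have sB: "pos_def (mat_sqrt B)"
    by (rule pos_def_mat_sqrt[OF B])
  have "mat_sqrt (matrix_inv B) = matrix_inv (mat_sqrt B)"
  proof (rule pos_semidef_square_root_unique)
    show "pos_semidef (mat_sqrt (matrix_inv B))"
      by (rule mat_sqrt(1)[OF psd(3)])
    show "pos_semidef (matrix_inv (mat_sqrt B))"
      by (intro pos_def_imp_pos_semidef pos_def_matrix_inv sB)
    have "B ** (matrix_inv (mat_sqrt B) ** matrix_inv (mat_sqrt B)) =
        mat_sqrt B ** (mat_sqrt B ** matrix_inv (mat_sqrt B)) ** matrix_inv (mat_sqrt B)"
      by (subst mat_sqrt(2)[OF psd(2), symmetric]) (simp add: matrix_mul_assoc)
    also have "\<dots> = mat 1"
      by (simp add: matrix_inv_mult[OF pos_def_invertible[OF sB]])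
    finally show "mat_sqrt (matrix_inv B) ** mat_sqrt (matrix_inv B) =
        matrix_inv (mat_sqrt B) ** matrix_inv (mat_sqrt B)"
      using mat_sqrt(2)[OF psd(3)] matrix_inv_unique by simp
  qed
  then have "A \<bullet> matrix_inv B = (norm T)\<^sup>2"
    using norm_mat_sqrt_mult[OF psd(1,3)] by (simp add: T_def)
  also have "\<dots> = (\<Sum>j\<in>UNIV. (norm (T *v axis j 1))\<^sup>2)"
    by (simp add: power2_norm_eq_inner inner_matrix_columns)
  also have "\<dots> \<le> (\<Sum>j\<in>(UNIV :: 'n set). (op_norm T)\<^sup>2)"
  proof (intro sum_mono power_mono norm_ge_zero)
    fix j
    have "bounded_linear (\<lambda>x. T *v x)"
      by (intro linear_conv_bounded_linear[THEN iffD1] linear_matrix_vector_right)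
    from onorm[OF this, of "axis j 1"] show "norm (T *v axis j 1) \<le> op_norm T"
      by (simp add: op_norm_def norm_axis_1)
  qed
  finally show ?thesis
    by (simp add: T_def)
qed

section \<open>Integrals of matrix functions\<close>

lemma set_integral_bounded_linear:
  assumes "bounded_linear T" "set_integrable M A f"
  shows "set_integrable M A (\<lambda>x. T (f x))" "(LINT x:A|M. T (f x)) = T (LINT x:A|M. f x)"
proof -
  have eq: "(\<lambda>x. indicator A x *\<^sub>R T (f x)) = (\<lambda>x. T (indicator A x *\<^sub>R f x))"
    by (simp add: linear_simps(5)[OF assms(1)])
  show "set_integrable M A (\<lambda>x. T (f x))" "(LINT x:A|M. T (f x)) = T (LINT x:A|M. f x)"
    using integrable_bounded_linear[OF assms(1)] integral_bounded_linear[OF assms(1)] assms(2)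
    unfolding set_integrable_def set_lebesgue_integral_def eq by blast+
qed

lemma bounded_linear_quadratic_form: "bounded_linear (\<lambda>A :: complex ^ 'n ^ 'm. (A *v x) \<bullet> y)"
  by (intro linear_conv_bounded_linear[THEN iffD1] linearI) (simp_all add: matrix_vector_linear inner_add_left)

lemma pos_def_set_integral:
  fixes G :: "'a \<Rightarrow> complex ^ 'n ^ 'n"
  assumes G: "set_integrable M A G" and A: "A \<in> sets M" "emeasure M A \<noteq> 0"
    and pd: "AE x in M. pos_def (G x)"
  shows "pos_def (LINT x:A|M. G x)"
  unfolding pos_def_iff
proof (intro conjI allI impI)
  have "conj_transpose (LINT x:A|M. G x) = (LINT x:A|M. conj_transpose (G x))"
    using set_integral_bounded_linear(2)[OF bounded_linear_conj_transpose G] by simp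
  also have "\<dots> = (LINT x:A|M. G x)"
    unfolding set_lebesgue_integral_def
  proof (rule integral_cong_AE)
    show "AE x in M. indicator A x *\<^sub>R conj_transpose (G x) = indicator A x *\<^sub>R G x"
      using pd by eventually_elim (auto simp: pos_def_iff hermitian_def)
  qed (use G set_integral_bounded_linear(1)[OF bounded_linear_conj_transpose G] in
       \<open>auto simp: set_integrable_def\<close>)
  finally show "hermitian (LINT x:A|M. G x)"
    by (simp add: hermitian_def)
next
  fix y :: "complex ^ 'n" assume y: "y \<noteq> 0"
  define g where "g x = indicator A x *\<^sub>R ((G x *v y) \<bullet> y)" for x
  have g: "integrable M g" and eq: "((LINT x:A|M. G x) *v y) \<bullet> y = integral\<^sup>L M g"
    using set_integral_bounded_linear[OF bounded_linear_quadratic_form G, of y y]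
    unfolding g_def set_integrable_def set_lebesgue_integral_def by auto
  have pos: "AE x in M. (x \<in> A \<longrightarrow> 0 < g x) \<and> 0 \<le> g x"
    using pd by eventually_elim (use y in \<open>auto simp: g_def pos_def_iff indicator_def\<close>)
  have "integral\<^sup>L M g \<noteq> 0"
  proof
    assume "integral\<^sup>L M g = 0"
    then have "AE x in M. g x = 0"
      using integral_nonneg_eq_0_iff_AE[OF g] pos by auto
    with pos have "AE x in M. x \<notin> A"
      by eventually_elim auto
    then have "A \<in> null_sets M"
      using A(1) by (simp add: AE_iff_null_sets)
    then show False
      using A(2) by auto
  qed
  moreover have "0 \<le> integral\<^sup>L M g"
    using pos by (intro integral_nonneg_AE) auto
  ultimately show "0 < ((LINT x:A|M. G x) *v y) \<bullet> y"
    by (simp add: eq)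
qed

lemma set_nn_integral_finite_imp_set_integrable:
  fixes g :: "'a \<Rightarrow> 'b :: {banach, second_countable_topology}"
  assumes g: "g \<in> borel_measurable M" and A: "A \<in> sets M"
    and bound: "AE x in M. norm (g x) \<le> h x" and fin: "(\<integral>\<^sup>+x\<in>A. ennreal (h x) \<partial>M) < \<infinity>"
  shows "set_integrable M A g"
  unfolding set_integrable_def integrable_iff_bounded
proof
  show "(\<lambda>x. indicator A x *\<^sub>R g x) \<in> borel_measurable M"
    using g A by measurable
  have "(\<integral>\<^sup>+x. ennreal (norm (indicator A x *\<^sub>R g x)) \<partial>M) \<le> (\<integral>\<^sup>+x\<in>A. ennreal (h x) \<partial>M)"
    using bound by (intro nn_integral_mono_AE, eventually_elim) (auto simp: indicator_def ennreal_leI)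
  with fin show "(\<integral>\<^sup>+x. ennreal (norm (indicator A x *\<^sub>R g x)) \<partial>M) < \<infinity>"
    by (rule le_less_trans[rotated])
qed

lemma set_nn_integral_eq_set_integral:
  assumes "set_integrable M A g" "AE x in M. 0 \<le> g x"
  shows "(\<integral>\<^sup>+x\<in>A. ennreal (g x) \<partial>M) = ennreal (LINT x:A|M. g x)"
proof -
  have "(\<integral>\<^sup>+x\<in>A. ennreal (g x) \<partial>M) = (\<integral>\<^sup>+x. ennreal (indicator A x *\<^sub>R g x) \<partial>M)"
    by (intro nn_integral_cong) (auto simp: indicator_def)
  also have "\<dots> = ennreal (LINT x:A|M. g x)"
    unfolding set_lebesgue_integral_def
    using assms by (intro nn_integral_eq_integral) (auto simp: set_integrable_def)
  finally show ?thesis .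
qed

lemma set_integral_mono_AE:
  fixes f g :: "'a \<Rightarrow> real"
  assumes "set_integrable M A f" "set_integrable M A g" "AE x in M. f x \<le> g x"
  shows "(LINT x:A|M. f x) \<le> (LINT x:A|M. g x)"
  using assms unfolding set_integrable_def set_lebesgue_integral_def
  by (intro integral_mono_AE) (auto simp: indicator_def)

section \<open>Local integrability of a matrix weight and its inverse\<close>

lemma half_open_cube_in_closed_cube:
  assumes "J = half_open_cube a l" "0 < l"
  obtains I where "I \<in> {cube a l | a l. l > 0}" "J \<subseteq> I" "emeasure lebesgue I = emeasure lebesgue J"
proof
  show "cube a l \<in> {cube a l | a l. l > 0}"
    using assms by blast
  show "J \<subseteq> cube a l" "emeasure lebesgue (cube a l) = emeasure lebesgue J"
    using half_open_cube_measure[OF assms(2), of a] assms(1) emeasure_eq_measure2 by metis+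
qed

locale A2_matrix_weight =
  fixes W :: "real ^ 'd \<Rightarrow> complex ^ 'n ^ 'n"
  assumes A2: "A2_weight W"
begin

definition V :: "real ^ 'd \<Rightarrow> complex ^ 'n ^ 'n" where
  "V x = matrix_inv (W x)"

lemma W_measurable [measurable]: "W \<in> borel_measurable lebesgue"
  using A2 by (simp add: A2_weight_def)

lemma V_measurable [measurable]: "V \<in> borel_measurable lebesgue"
  unfolding V_def by (rule measurable_compose[OF W_measurable measurable_matrix_inv])

lemma pos_def_W: "AE x in lebesgue. pos_def (W x)"
  using A2 by (simp add: A2_weight_def)

lemma pos_def_V: "AE x in lebesgue. pos_def (V x)"
  using pos_def_W unfolding V_def by eventually_elim (rule pos_def_matrix_inv)

definition q :: real where "q = enn2real (A2_char W)"

lemma q: "A2_char W = ennreal q" "0 \<le> q"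
  using A2 by (auto simp: A2_weight_def q_def)

text \<open>The integrand of the \<open>A\<^sub>2\<close> characteristic dominates \<open>W x \<bullet> V t / n\<close>. Finiteness of the inner integral
for a single positive definite \<open>W x\<close> makes \<open>V\<close> integrable. The inner integral is then at least
\<open>W x \<bullet> V\<^sub>J / n\<close> with \<open>V\<^sub>J\<close> the integral of \<open>V\<close>, which is positive definite, so that finiteness of the
outer integral makes \<open>W\<close> integrable and bounds the product of the two integrals. The inner integral is
bounded below by measurable functions of \<open>x\<close> throughout, so its own measurability in \<open>x\<close> never
comes into question.\<close>

lemma A2_integrals:
  assumes J: "J = half_open_cube a l" "0 < l"
  shows "set_integrable lebesgue J W" "set_integrable lebesgue J V"
    "(LINT x:J|lebesgue. W x) \<bullet> (LINT x:J|lebesgue. V x) \<le> CARD('n) * q * (measure lebesgue J)\<^sup>2"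
proof -
  define n where "n = real CARD('n)"
  define m where "m = measure lebesgue J"
  have n: "0 < n" by (simp add: n_def)
  have Jm: "J \<in> lmeasurable" and m: "0 < m"
    using half_open_cube_measure[OF J(2), of a] J by (auto simp: m_def)
  then have [measurable]: "J \<in> sets lebesgue" by auto
  have emJ: "emeasure lebesgue J = ennreal m"
    unfolding m_def by (rule emeasure_eq_measure2[OF Jm])
  obtain I where I: "I \<in> {cube a l | a l. l > 0}" "J \<subseteq> I" "emeasure lebesgue I = ennreal m"
    unfolding emJ[symmetric] by (rule half_open_cube_in_closed_cube[OF J])
  define inner where "inner x = (\<integral>\<^sup>+t\<in>I. ennreal ((op_norm (mat_sqrt (W x) ** matrix_inv (mat_sqrt (W t))))\<^sup>2)
              \<partial>lebesgue)" for x
  have A2_outer: "(\<integral>\<^sup>+x\<in>I. inner x / ennreal m \<partial>lebesgue) \<le> ennreal (q * m)" (is "?X \<le> _")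
  proof -
    have "?X = ?X / ennreal m * ennreal m"
      using m by (simp add: ennreal_divide_times)
    also have "?X / ennreal m \<le> A2_char W"
      unfolding A2_char_def inner_def I(3)[symmetric] by (rule SUP_upper[OF I(1)])
    finally show ?thesis
      using q m by (simp add: ennreal_mult mult_right_mono)
  qed
  have inner_ge: "AE x in lebesgue. (\<integral>\<^sup>+t\<in>J. ennreal ((W x \<bullet> V t) / n) \<partial>lebesgue) \<le> inner x"
    using pos_def_W
  proof eventually_elim
    case (elim x)
    show ?case
      unfolding inner_def
    proof (intro nn_integral_mono_AE)
      show "AE t in lebesgue. ennreal ((W x \<bullet> V t) / n) * indicator J t
         \<le> ennreal ((op_norm (mat_sqrt (W x) ** matrix_inv (mat_sqrt (W t))))\<^sup>2) * indicator I t"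
        using pos_def_W
      proof eventually_elim
        case (elim t)
        have "(W x \<bullet> V t) / n \<le> (op_norm (mat_sqrt (W x) ** matrix_inv (mat_sqrt (W t))))\<^sup>2"
          using inner_le_op_norm[OF \<open>pos_def (W x)\<close> elim] n by (simp add: V_def n_def divide_le_eq mult.commute)
        then show ?case
          using I(2) by (auto simp: indicator_def ennreal_leI)
      qed
    qed
  qed
  have trace_V: "AE t in lebesgue. norm (V t) \<le> mat 1 \<bullet> V t"
    using pos_def_V by eventually_elim (intro pos_semidef_norm_le_trace pos_def_imp_pos_semidef)
  have trace_W: "AE t in lebesgue. norm (W t) \<le> mat 1 \<bullet> W t"
    using pos_def_W by eventually_elim (intro pos_semidef_norm_le_trace pos_def_imp_pos_semidef)
  have fin: "(\<integral>\<^sup>+t\<in>J. ennreal (mat 1 \<bullet> V t) \<partial>lebesgue) < \<infinity>"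
  proof (rule ccontr)
    assume "\<not> ?thesis"
    then have inf: "(\<integral>\<^sup>+t\<in>J. ennreal (mat 1 \<bullet> V t) \<partial>lebesgue) = \<infinity>"
      by (simp add: less_top[symmetric])
    have "AE x in lebesgue. \<infinity> * indicator J x \<le> inner x / ennreal m * indicator I x"
      using inner_ge pos_def_W
    proof eventually_elim
      case (elim x)
      obtain r where r: "0 < r" "\<And>B. pos_semidef B \<Longrightarrow> r * (mat 1 \<bullet> B) \<le> W x \<bullet> B"
        using pos_def_inner_lower_bound[OF elim(2)] by metis
      have "ennreal (r / n) * (\<integral>\<^sup>+t\<in>J. ennreal (mat 1 \<bullet> V t) \<partial>lebesgue)
          = (\<integral>\<^sup>+t. ennreal (r / n) * (ennreal (mat 1 \<bullet> V t) * indicator J t) \<partial>lebesgue)"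
        by (intro nn_integral_cmult[symmetric]) measurable
      also have "\<dots> \<le> (\<integral>\<^sup>+t\<in>J. ennreal ((W x \<bullet> V t) / n) \<partial>lebesgue)"
      proof (intro nn_integral_mono_AE)
        show "AE t in lebesgue. ennreal (r / n) * (ennreal (mat 1 \<bullet> V t) * indicator J t)
            \<le> ennreal ((W x \<bullet> V t) / n) * indicator J t"
          using pos_def_V
        proof eventually_elim
          case (elim t)
          have "r / n * (mat 1 \<bullet> V t) \<le> (W x \<bullet> V t) / n"
            using r(2)[OF pos_def_imp_pos_semidef[OF elim]] n by (simp add: divide_right_mono)
          then show ?case
            using r n by (auto simp: indicator_def ennreal_mult'[symmetric] intro: ennreal_leI)
        qed
      qed
      finally have "inner x = \<infinity>"
        using elim(1) r n by (simp add: inf ennreal_mult_top top_unique)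
      then show ?case
        using I(2) by (auto simp: indicator_def ennreal_top_divide)
    qed
    then have "(\<integral>\<^sup>+x\<in>J. \<infinity> \<partial>lebesgue) \<le> (\<integral>\<^sup>+x\<in>I. inner x / ennreal m \<partial>lebesgue)"
      by (rule nn_integral_mono_AE)
    also have "\<dots> \<le> ennreal (q * m)"
      by (rule A2_outer)
    also have "(\<integral>\<^sup>+x\<in>J. \<infinity> \<partial>lebesgue) = \<infinity>"
      using m by (subst nn_integral_cmult_indicator) (simp_all add: emJ ennreal_top_mult del: emeasure_completion)
    finally show False
      by (simp add: top_unique)
  qed
  show V_int: "set_integrable lebesgue J V"
    by (rule set_nn_integral_finite_imp_set_integrable[OF _ _ trace_V fin]) simp_all
  define VJ where "VJ = (LINT x:J|lebesgue. V x)"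
  have emJ0: "emeasure lebesgue J \<noteq> 0"
    using m by (simp add: emJ del: emeasure_completion)
  have VJ: "pos_def VJ"
    unfolding VJ_def by (rule pos_def_set_integral[OF V_int _ emJ0 pos_def_V]) simp
  have bl: "bounded_linear (\<lambda>B :: complex ^ 'n ^ 'n. (A \<bullet> B) / n)" for A
    by (intro bounded_linear_divide[THEN bounded_linear_compose] bounded_linear_inner_right)
  have nonneg: "AE x in lebesgue. 0 \<le> W x \<bullet> VJ"
    using pos_def_W by eventually_elim (auto intro!: inner_pos_semidef_nonneg pos_def_imp_pos_semidef VJ)
  have "AE x in lebesgue. ennreal ((W x \<bullet> VJ) / (n * m)) * indicator J x \<le> inner x / ennreal m * indicator I x"
    using inner_ge pos_def_W nonneg
  proof eventually_elim
    case (elim x)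
    have "AE t in lebesgue. 0 \<le> (W x \<bullet> V t) / n"
      using pos_def_V by eventually_elim (auto intro!: divide_nonneg_pos inner_pos_semidef_nonneg pos_def_imp_pos_semidef elim(2) n)
    then have "(\<integral>\<^sup>+t\<in>J. ennreal ((W x \<bullet> V t) / n) \<partial>lebesgue) = ennreal ((W x \<bullet> VJ) / n)"
      unfolding VJ_def set_integral_bounded_linear(2)[OF bl V_int, symmetric]
      by (rule set_nn_integral_eq_set_integral[OF set_integral_bounded_linear(1)[OF bl V_int]])
    then have "ennreal ((W x \<bullet> VJ) / n) \<le> inner x"
      using elim(1) by simp
    then have "ennreal ((W x \<bullet> VJ) / n) / ennreal m \<le> inner x / ennreal m"
      by (rule divide_right_mono_ennreal)
    also have "ennreal ((W x \<bullet> VJ) / n) / ennreal m = ennreal ((W x \<bullet> VJ) / (n * m))"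
      using elim n m by (subst divide_ennreal) auto
    finally show ?case
      using I(2) by (auto simp: indicator_def)
  qed
  then have "(\<integral>\<^sup>+x\<in>J. ennreal ((W x \<bullet> VJ) / (n * m)) \<partial>lebesgue) \<le> (\<integral>\<^sup>+x\<in>I. inner x / ennreal m \<partial>lebesgue)"
    by (rule nn_integral_mono_AE)
  with A2_outer have W_bound: "(\<integral>\<^sup>+x\<in>J. ennreal ((W x \<bullet> VJ) / (n * m)) \<partial>lebesgue) \<le> ennreal (q * m)"
    by (rule order_trans[rotated])
  obtain r where r: "0 < r" "\<And>B. pos_semidef B \<Longrightarrow> r * (mat 1 \<bullet> B) \<le> VJ \<bullet> B"
    using pos_def_inner_lower_bound[OF VJ] by metis
  have "set_integrable lebesgue J (\<lambda>x. (r / (n * m)) *\<^sub>R W x)"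
  proof (rule set_nn_integral_finite_imp_set_integrable)
    show "(\<integral>\<^sup>+x\<in>J. ennreal ((W x \<bullet> VJ) / (n * m)) \<partial>lebesgue) < \<infinity>"
      using W_bound by (rule le_less_trans) simp
    show "AE x in lebesgue. norm ((r / (n * m)) *\<^sub>R W x) \<le> (W x \<bullet> VJ) / (n * m)"
      using pos_def_W trace_W
    proof eventually_elim
      case (elim x)
      have "r * norm (W x) \<le> r * (mat 1 \<bullet> W x)"
        using elim(2) r by simp
      also have "\<dots> \<le> W x \<bullet> VJ"
        using r(2)[OF pos_def_imp_pos_semidef[OF elim(1)]] by (simp add: inner_commute)
      finally show ?case
        using r n m by (simp add: divide_right_mono)
    qed
  qed simp_all
  from set_integral_bounded_linear(1)[OF bounded_linear_scaleR_right[of "n * m / r"] this]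
  show W_int: "set_integrable lebesgue J W"
    using r n m by simp
  have bl': "bounded_linear (\<lambda>B :: complex ^ 'n ^ 'n. (B \<bullet> VJ) / (n * m))"
    by (intro bounded_linear_divide[THEN bounded_linear_compose] bounded_linear_inner_left)
  have "ennreal (((LINT x:J|lebesgue. W x) \<bullet> VJ) / (n * m)) = (\<integral>\<^sup>+x\<in>J. ennreal ((W x \<bullet> VJ) / (n * m)) \<partial>lebesgue)"
    unfolding set_integral_bounded_linear(2)[OF bl' W_int, symmetric] using nonneg n m
    by (intro set_nn_integral_eq_set_integral[symmetric] set_integral_bounded_linear(1)[OF bl' W_int])
       (auto elim!: eventually_mono)
  with W_bound have "ennreal (((LINT x:J|lebesgue. W x) \<bullet> VJ) / (n * m)) \<le> ennreal (q * m)"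
    by simp
  then have "((LINT x:J|lebesgue. W x) \<bullet> VJ) / (n * m) \<le> q * m"
    using q(2) m by (simp only: ennreal_le_iff mult_nonneg_nonneg less_imp_le)
  then show "(LINT x:J|lebesgue. W x) \<bullet> (LINT x:J|lebesgue. V x) \<le> CARD('n) * q * (measure lebesgue J)\<^sup>2"
    using n m by (simp add: VJ_def n_def[symmetric] m_def[symmetric] divide_le_eq power2_eq_square ac_simps)
qed

end

section \<open>Averages over cubes\<close>

definition mean :: "(real ^ 'd) set \<Rightarrow> (real ^ 'd \<Rightarrow> 'a :: euclidean_space) \<Rightarrow> 'a" where
  "mean J g = (1 / measure lebesgue J) *\<^sub>R (LINT x:J|lebesgue. g x)"

lemma avg_eq_mean: "avg J g = mean J g"
  by (simp add: avg_def mean_def)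

lemma mean_bounded_linear:
  assumes "bounded_linear T" "set_integrable lebesgue J g"
  shows "mean J (\<lambda>x. T (g x)) = T (mean J g)"
  by (simp add: mean_def set_integral_bounded_linear(2)[OF assms] linear_simps(5)[OF assms(1)])

lemma mean_mono_AE:
  fixes g h :: "real ^ 'd \<Rightarrow> real"
  assumes "set_integrable lebesgue J g" "set_integrable lebesgue J h" "AE x in lebesgue. g x \<le> h x"
  shows "mean J g \<le> mean J h"
  by (simp add: mean_def divide_right_mono set_integral_mono_AE[OF assms])

lemma mean_finite_Union:
  fixes g :: "real ^ 'd \<Rightarrow> 'a :: euclidean_space"
  assumes C: "finite C" "disjoint C" "\<Union> C = J" and J: "measure lebesgue J > 0"
    and K: "\<And>K. K \<in> C \<Longrightarrow> K \<in> lmeasurable" "\<And>K. K \<in> C \<Longrightarrow> measure lebesgue K > 0"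
    and int: "\<And>K. K \<in> C \<Longrightarrow> set_integrable lebesgue K g"
  shows "mean J g = (\<Sum>K\<in>C. (measure lebesgue K / measure lebesgue J) *\<^sub>R mean K g)"
    "(\<Sum>K\<in>C. measure lebesgue K / measure lebesgue J) = 1"
proof -
  have disj: "disjoint_family_on (\<lambda>K. K) C"
    using C(2) unfolding disjoint_def disjoint_family_on_def by blast
  have "(LINT x:J|lebesgue. g x) = (LINT x:(\<Union>K\<in>C. K)|lebesgue. g x)"
    using C(3) by simp
  also have "\<dots> = (\<Sum>K\<in>C. LINT x:K|lebesgue. g x)"
    by (rule set_integral_finite_Union[OF C(1) disj int]) (use K in auto)
  finally have "mean J g = (\<Sum>K\<in>C. (1 / measure lebesgue J) *\<^sub>R (LINT x:K|lebesgue. g x))"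
    by (simp add: mean_def scaleR_sum_right)
  also have "\<dots> = (\<Sum>K\<in>C. (measure lebesgue K / measure lebesgue J) *\<^sub>R mean K g)"
    using K(2) by (intro sum.cong) (auto simp: mean_def dest: less_imp_neq[THEN not_sym])
  finally show "mean J g = (\<Sum>K\<in>C. (measure lebesgue K / measure lebesgue J) *\<^sub>R mean K g)" .
  have "measure lebesgue (\<Union>K\<in>C. K) = (\<Sum>K\<in>C. measure lebesgue K)"
    by (rule measure_finite_Union[OF C(1) _ disj])
       (use fmeasurableD[OF K(1)] fmeasurableD2[OF K(1)] in auto)
  then show "(\<Sum>K\<in>C. measure lebesgue K / measure lebesgue J) = 1"
    using C(3) J by (simp add: sum_divide_distrib[symmetric])
qed

lemma measurable_quadratic_form:
  fixes G :: "'a \<Rightarrow> complex ^ 'n ^ 'n"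
  assumes "G \<in> borel_measurable M" "g \<in> borel_measurable M"
  shows "(\<lambda>x. (G x *v g x) \<bullet> g x) \<in> borel_measurable M"
proof (rule borel_measurable_continuous_Pair[OF assms])
  show "continuous_on UNIV (\<lambda>p :: (complex ^ 'n ^ 'n) \<times> (complex ^ 'n). (fst p *v snd p) \<bullet> snd p)"
    unfolding matrix_vector_mult_def by (intro continuous_intros continuous_on_vec_lambda)
qed

locale A2_weighted_function = A2_matrix_weight W for W :: "real ^ 'd \<Rightarrow> complex ^ 'n ^ 'n" +
  fixes f :: "real ^ 'd \<Rightarrow> complex ^ 'n"
  assumes f: "f \<in> L2W W"
begin

definition energy :: "real ^ 'd \<Rightarrow> real" where
  "energy x = (W x *v f x) \<bullet> f x"

lemma f_measurable [measurable]: "f \<in> borel_measurable lebesgue"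
  using f by (simp add: L2W_def)

lemma energy_measurable [measurable]: "energy \<in> borel_measurable lebesgue"
  unfolding energy_def by (rule measurable_quadratic_form) simp_all

lemma energy_nonneg: "AE x in lebesgue. 0 \<le> energy x"
  using pos_def_W by eventually_elim (use pos_def_imp_pos_semidef in \<open>auto simp: energy_def pos_semidef_iff\<close>)

lemma energy_norm: "L2W_norm_sq W f = (\<integral>\<^sup>+x. ennreal (energy x) \<partial>lebesgue)"
  unfolding L2W_norm_sq_def
proof (rule nn_integral_cong_AE)
  show "AE x in lebesgue. ennreal ((norm (mat_sqrt (W x) *v f x))\<^sup>2) = ennreal (energy x)"
    using pos_def_W by eventually_elim (simp add: energy_def norm_mat_sqrt_vector pos_def_imp_pos_semidef)
qed

lemma energy_integrable: "integrable lebesgue energy"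
proof (rule integrableI_bounded)
  have "(\<integral>\<^sup>+x. ennreal (norm (energy x)) \<partial>lebesgue) = L2W_norm_sq W f"
    unfolding energy_norm using energy_nonneg by (intro nn_integral_cong_AE) (auto elim!: eventually_mono)
  then show "(\<integral>\<^sup>+x. ennreal (norm (energy x)) \<partial>lebesgue) < \<infinity>"
    using f by (simp add: L2W_def)
qed simp

lemma energy_integral: "L2W_norm_sq W f = ennreal (integral\<^sup>L lebesgue energy)"
  unfolding energy_norm by (rule nn_integral_eq_integral[OF energy_integrable energy_nonneg])

lemma energy_set_integrable: "J \<in> sets lebesgue \<Longrightarrow> set_integrable lebesgue J energy"
  unfolding set_integrable_def using integrable_mult_indicator[OF _ energy_integrable] by blast

lemma half_open_cube_positive:
  assumes "J = half_open_cube a l" "0 < l"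
  shows "J \<in> sets lebesgue" "0 < measure lebesgue J" "emeasure lebesgue J \<noteq> 0"
proof -
  have J: "J \<in> lmeasurable" "0 < measure lebesgue J"
    using half_open_cube_measure[OF assms(2), of a] assms by auto
  then show "J \<in> sets lebesgue" "0 < measure lebesgue J" by auto
  show "emeasure lebesgue J \<noteq> 0"
    using J by (auto simp: measure_def simp del: emeasure_completion)
qed

text \<open>\<open>|f|\<^sup>2 \<le> (trace V) \<langle>W f, f\<rangle>\<close>, so \<open>|f|\<close> is at most the sum of two locally integrable functions.\<close>

lemma f_set_integrable:
  assumes J: "J = half_open_cube a l" "0 < l"
  shows "set_integrable lebesgue J f"
proof -
  have "set_integrable lebesgue J (\<lambda>x. (V x \<bullet> mat 1) + energy x)"
    using set_integral_bounded_linear(1)[OF bounded_linear_inner_left A2_integrals(2)[OF J]]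
      energy_set_integrable[OF half_open_cube_positive(1)[OF J]]
    by (intro set_integral_add)
  then have "integrable lebesgue (\<lambda>x. indicator J x *\<^sub>R ((V x \<bullet> mat 1) + energy x))"
    by (simp add: set_integrable_def)
  then show ?thesis
    unfolding set_integrable_def
  proof (rule Bochner_Integration.integrable_bound)
    show "AE x in lebesgue. norm (indicator J x *\<^sub>R f x) \<le> norm (indicator J x *\<^sub>R ((V x \<bullet> mat 1) + energy x))"
      using pos_def_W pos_def_V energy_nonneg
    proof eventually_elim
      case (elim x)
      have V0: "0 \<le> V x \<bullet> mat 1"
        using elim(2) by (intro inner_pos_semidef_nonneg pos_def_imp_pos_semidef pos_semidef_intros)
      have "(norm (f x))\<^sup>2 \<le> (V x \<bullet> mat 1) * energy x"
        using quadratic_form_le_inner[OF elim(1) pos_semidef_intros(3), of "f x"]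
        by (simp add: V_def energy_def power2_norm_eq_inner)
      also have "\<dots> \<le> ((V x \<bullet> mat 1) + energy x)\<^sup>2"
        using V0 elim(3) by (simp add: power2_eq_square algebra_simps)
      finally have "norm (f x) \<le> (V x \<bullet> mat 1) + energy x"
        by (rule power2_le_imp_le) (use V0 elim(3) in simp)
      then show ?case
        using V0 elim(3) by (simp add: indicator_def)
    qed
    show "(\<lambda>x. indicator J x *\<^sub>R f x) \<in> borel_measurable lebesgue"
      using half_open_cube_positive(1)[OF J] by measurable
  qed
qed

lemma pos_def_means:
  assumes J: "J = half_open_cube a l" "0 < l"
  shows "pos_def (mean J W)" "pos_def (mean J V)"
  unfolding mean_def
  by (intro pos_def_scaleR pos_def_set_integral A2_integrals[OF J] half_open_cube_positive[OF J] pos_def_W pos_def_V;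
      use half_open_cube_positive[OF J] in simp)+

text \<open>Pointwise \<open>2 (g \<bullet> z) \<le> \<langle>W g, g\<rangle> + \<langle>V z, z\<rangle>\<close> for every fixed \<open>z\<close>; average over \<open>J\<close> and choose
\<open>z = V\<^sub>J\<^sup>-\<^sup>1 g\<^sub>J\<close>. For \<open>g = f\<close> this bounds the last term of the Bellman function, and for constant \<open>g\<close>
it is \<open>V\<^sub>J\<^sup>-\<^sup>1 \<le> W\<^sub>J\<close>.\<close>

lemma mean_matrix_inv_le:
  assumes J: "J = half_open_cube a l" "0 < l"
    and g: "set_integrable lebesgue J g" and h: "set_integrable lebesgue J h"
    and le: "AE x in lebesgue. (W x *v g x) \<bullet> g x \<le> h x"
  shows "(matrix_inv (mean J V) *v mean J g) \<bullet> mean J g \<le> mean J h"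
proof -
  define z where "z = matrix_inv (mean J V) *v mean J g"
  have V_int: "set_integrable lebesgue J V" by (rule A2_integrals[OF J])
  have b1: "bounded_linear (\<lambda>y :: complex ^ 'n. 2 * (y \<bullet> z))"
    by (intro bounded_linear_mult_right[THEN bounded_linear_compose] bounded_linear_inner_left)
  note b2 = bounded_linear_quadratic_form[of z z]
  have "mean J (\<lambda>x. 2 * (g x \<bullet> z)) \<le> mean J (\<lambda>x. h x + (V x *v z) \<bullet> z)"
  proof (rule mean_mono_AE)
    show "set_integrable lebesgue J (\<lambda>x. 2 * (g x \<bullet> z))"
      by (rule set_integral_bounded_linear(1)[OF b1 g])
    show "set_integrable lebesgue J (\<lambda>x. h x + (V x *v z) \<bullet> z)"
      by (intro set_integral_add h set_integral_bounded_linear(1)[OF b2 V_int])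
    show "AE x in lebesgue. 2 * (g x \<bullet> z) \<le> h x + (V x *v z) \<bullet> z"
      using pos_def_W le
    proof eventually_elim
      case (elim x)
      have "2 * (g x \<bullet> z) - (V x *v z) \<bullet> z \<le> (W x *v g x) \<bullet> g x"
        using matrix_inv_inner_ge[OF pos_def_matrix_inv[OF elim(1)], of "g x" z]
        by (simp add: V_def matrix_inv_matrix_inv[OF elim(1)])
      with elim(2) show ?case by linarith
    qed
  qed
  moreover have "mean J (\<lambda>x. h x + (V x *v z) \<bullet> z) = mean J h + (mean J V *v z) \<bullet> z"
    using mean_bounded_linear[OF b2 V_int] h set_integral_bounded_linear(1)[OF b2 V_int]
    by (simp add: mean_def add_divide_distrib)
  moreover have "mean J V *v z = mean J g"
    by (simp add: z_def matrix_inv_vector[OF pos_def_means(2)[OF J]])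
  moreover have "mean J (\<lambda>x. 2 * (g x \<bullet> z)) = 2 * (mean J g \<bullet> z)"
    by (rule mean_bounded_linear[OF b1 g])
  ultimately show ?thesis
    by (simp add: z_def[symmetric] inner_commute[of z])
qed

lemma admissible_means:
  assumes J: "J = half_open_cube a l" "0 < l" and N: "pos_semidef N" "pos_semidef (mean J W - N)"
  shows "admissible (CARD('n) * q) (mean J W) (mean J V) N (mean J energy) (mean J f)"
  unfolding admissible_def
proof (intro conjI allI pos_def_means[OF J] N)
  have m: "0 < measure lebesgue J" by (rule half_open_cube_positive[OF J])
  show "mean J W \<bullet> mean J V \<le> CARD('n) * q"
    using A2_integrals(3)[OF J] m by (simp add: mean_def divide_le_eq power2_eq_square)
  show "(matrix_inv (mean J V) *v mean J f) \<bullet> mean J f \<le> mean J energy"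
    by (rule mean_matrix_inv_le[OF J f_set_integrable[OF J]])
       (auto simp: energy_def intro: energy_set_integrable half_open_cube_positive[OF J])
  fix y :: "complex ^ 'n"
  note b = bounded_linear_quadratic_form[of y y]
  have const: "set_integrable lebesgue J (\<lambda>x. y)" "mean J (\<lambda>x. y) = y"
    using half_open_cube_measure(1)[OF J(2), of a] m J(1)
    by (auto simp: mean_def set_integrable_def set_lebesgue_integral_def fmeasurable_def less_top)
  have "(matrix_inv (mean J V) *v mean J (\<lambda>x. y)) \<bullet> mean J (\<lambda>x. y) \<le> mean J (\<lambda>x. (W x *v y) \<bullet> y)"
    by (rule mean_matrix_inv_le[OF J const(1) set_integral_bounded_linear(1)[OF b A2_integrals(1)[OF J]]]) simp
  then show "(matrix_inv (mean J V) *v y) \<bullet> y \<le> (mean J W *v y) \<bullet> y"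
    by (simp add: const(2) mean_bounded_linear[OF b A2_integrals(1)[OF J]])
qed

end

section \<open>The embedding theorem\<close>

lemma finite_Sig: "finite (Sig :: (nat ^ 'd) set)"
proof (rule finite_subset)
  show "Sig \<subseteq> vec_lambda ` (UNIV \<rightarrow>\<^sub>E {0, 1} :: ('d \<Rightarrow> nat) set)"
  proof
    fix e :: "nat ^ 'd" assume "e \<in> Sig"
    then have "vec_nth e \<in> UNIV \<rightarrow>\<^sub>E {0, 1}"
      by (auto simp: Sig_def PiE_def)
    then show "e \<in> vec_lambda ` (UNIV \<rightarrow>\<^sub>E {0, 1})"
      by (intro image_eqI[of _ _ "vec_nth e"]) simp_all
  qed
  show "finite (vec_lambda ` (UNIV \<rightarrow>\<^sub>E {0, 1} :: ('d \<Rightarrow> nat) set))"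
    by (intro finite_imageI finite_PiE) auto
qed

text \<open>The packing sums of the Bellman function range over a finite set \<open>S\<close> of cubes. They are dominated by
the full series in the packing condition, and the bound does not depend on \<open>S\<close>.\<close>

locale carleson_embedding = A2_weighted_function W f
  for W :: "real ^ 'd \<Rightarrow> complex ^ 'n ^ 'n" and f +
  fixes D :: "(real ^ 'd) set set" and A :: "(real ^ 'd) set \<Rightarrow> nat ^ 'd \<Rightarrow> complex ^ 'n ^ 'n" and C :: real
    and S :: "(real ^ 'd) set set"
  assumes D: "dyadic_grid D" and C: "C > 0" and carleson: "matrix_carleson W D A C"
    and S: "finite S" "S \<subseteq> D"
begin

definition gram_sum :: "(real ^ 'd) set \<Rightarrow> complex ^ 'n ^ 'n" where
  "gram_sum I = (\<Sum>\<epsilon>\<in>Sig. conj_transpose (A I \<epsilon>) ** A I \<epsilon>)"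

text \<open>Divided by \<open>C |J|\<close>, the packing condition says that this matrix is dominated by the mean of \<open>W\<close>.\<close>

definition packing :: "(real ^ 'd) set \<Rightarrow> complex ^ 'n ^ 'n" where
  "packing J = (1 / (C * measure lebesgue J)) *\<^sub>R (\<Sum>I\<in>{I \<in> S. I \<subseteq> J}. gram_sum I)"

abbreviation "kappa \<equiv> CARD('n) * q"

definition cube_bellman :: "(real ^ 'd) set \<Rightarrow> real" where
  "cube_bellman J = bellman kappa (mean J W) (mean J V) (packing J) (mean J energy) (mean J f)"

lemma pos_semidef_gram_sum: "pos_semidef (gram_sum I)"
  unfolding gram_sum_def by (intro pos_semidef_sum pos_semidef_gram)

lemma gram_sum_quadratic_form: "(gram_sum I *v x) \<bullet> x = (\<Sum>\<epsilon>\<in>Sig. (norm (A I \<epsilon> *v x))\<^sup>2)"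
  by (simp add: gram_sum_def linear_sum[OF linear_matrix_vector_left] inner_sum_left gram_quadratic_form)

lemma grid_cube:
  assumes "J \<in> grid_level D k"
  obtains a where "J = half_open_cube a (2 powi k)" "(0::real) < 2 powi k"
  using assms by (auto simp: grid_level_def)

lemma measure_pos: "J \<in> D \<Longrightarrow> 0 < measure lebesgue J"
  using grid_has_level[OF D] grid_level_measure(3)[OF D] by blast

lemma pos_semidef_packing: "J \<in> D \<Longrightarrow> pos_semidef (packing J)"
  unfolding packing_def using C measure_pos
  by (intro pos_semidef_intros(2) pos_semidef_sum pos_semidef_gram_sum) (simp add: less_imp_le)

lemma packing_le:
  assumes J: "J \<in> D"
  shows "pos_semidef (mean J W - packing J)"
proof -
  define m where "m = measure lebesgue J"
  have m: "0 < m"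
    unfolding m_def by (rule measure_pos[OF J])
  define G where "G \<epsilon> I = conj_transpose (A I \<epsilon>) ** A I \<epsilon>" for \<epsilon> I
  define T where "T = {I \<in> S. I \<subseteq> J}"
  have T: "finite T" "T \<subseteq> subcubes D J"
    using S by (auto simp: T_def subcubes_def)
  have summ: "G \<epsilon> summable_on subcubes D J" if "\<epsilon> \<in> Sig" for \<epsilon>
    using carleson J that unfolding matrix_carleson_def G_def by blast
  define total where "total = (\<Sum>\<epsilon>\<in>Sig. \<Sum>\<^sub>\<infinity>I\<in>subcubes D J. G \<epsilon> I)"
  have less: "pos_def (C *\<^sub>R (LINT x:J|lebesgue. W x) - total)"
    using carleson J unfolding matrix_carleson_def loewner_less_def G_def total_def by blast
  have le: "((\<Sum>I\<in>T. gram_sum I) *v x) \<bullet> x \<le> ((C *\<^sub>R (LINT x:J|lebesgue. W x)) *v x) \<bullet> x" for x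
  proof -
    note b = bounded_linear_quadratic_form[of x x]
    have part: "(\<Sum>I\<in>T. (G \<epsilon> I *v x) \<bullet> x) \<le> ((\<Sum>\<^sub>\<infinity>I\<in>subcubes D J. G \<epsilon> I) *v x) \<bullet> x"
      if "\<epsilon> \<in> Sig" for \<epsilon>
    proof -
      have "(\<Sum>I\<in>T. (G \<epsilon> I *v x) \<bullet> x) \<le> (\<Sum>\<^sub>\<infinity>I\<in>subcubes D J. (G \<epsilon> I *v x) \<bullet> x)"
        using T by (intro finite_sum_le_infsum summable_on_bounded_linear[OF b summ[OF that]])
          (auto simp: G_def gram_quadratic_form)
      also have "\<dots> = ((\<Sum>\<^sub>\<infinity>I\<in>subcubes D J. G \<epsilon> I) *v x) \<bullet> x"
        by (intro infsumI has_sum_bounded_linear[OF b] has_sum_infsum summ that)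
      finally show ?thesis .
    qed
    have "((\<Sum>I\<in>T. gram_sum I) *v x) \<bullet> x = (\<Sum>\<epsilon>\<in>Sig. \<Sum>I\<in>T. (G \<epsilon> I *v x) \<bullet> x)"
      by (subst sum.swap) (simp add: gram_sum_def G_def linear_sum[OF linear_matrix_vector_left] inner_sum_left)
    also have "\<dots> \<le> (total *v x) \<bullet> x"
      unfolding total_def linear_sum[OF linear_matrix_vector_left] inner_sum_left
      by (intro sum_mono part)
    also have "\<dots> \<le> ((C *\<^sub>R (LINT x:J|lebesgue. W x)) *v x) \<bullet> x"
      using pos_def_imp_pos_semidef[OF less]
      by (simp add: pos_semidef_iff matrix_vector_linear(2) inner_diff_left)
    finally show ?thesis .
  qed
  have herm: "hermitian (mean J W)"
    using grid_has_level[OF D J] grid_cube pos_def_means(1) pos_def_iff by metis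
  have "0 \<le> ((mean J W - packing J) *v x) \<bullet> x" for x
  proof -
    have "(packing J *v x) \<bullet> x = ((\<Sum>I\<in>T. gram_sum I) *v x) \<bullet> x / (C * m)"
      by (simp add: packing_def matrix_vector_linear T_def m_def)
    also have "\<dots> \<le> ((C *\<^sub>R (LINT x:J|lebesgue. W x)) *v x) \<bullet> x / (C * m)"
      using le C m by (intro divide_right_mono) auto
    also have "\<dots> = (mean J W *v x) \<bullet> x"
      using C by (simp add: mean_def matrix_vector_linear m_def)
    finally show ?thesis
      by (simp add: matrix_vector_linear inner_diff_left)
  qed
  then show ?thesis
    using herm pos_semidef_packing[OF J] by (auto simp: pos_semidef_iff intro: hermitian_intros)
qed

lemma admissible_grid:
  assumes J: "J \<in> D"
  shows "admissible kappa (mean J W) (mean J V) (packing J) (mean J energy) (mean J f)"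
proof -
  obtain k where k: "J \<in> grid_level D k"
    using grid_has_level[OF D J] by blast
  obtain a where a: "J = half_open_cube a (2 powi k)" "(0::real) < 2 powi k"
    by (rule grid_cube[OF k])
  show ?thesis
    by (rule admissible_means[OF a pos_semidef_packing[OF J] packing_le[OF J]])
qed

lemma kappa_pos: "0 < kappa"
proof -
  obtain J where J: "J \<in> grid_level D 0"
    using grid_level_cover[OF D] by blast
  note adm = admissible_grid[OF grid_levelD[OF D J]]
  have "0 < mean J W \<bullet> mean J V"
    using adm by (intro inner_pos_def_pos) (auto simp: admissible_def)
  also have "\<dots> \<le> kappa"
    using adm by (simp add: admissible_def)
  finally show ?thesis .
qed

text \<open>The gain of the Bellman function, multiplied by \<open>64 \<kappa>\<^sup>3 C |J|\<close>. The increment of the packing sum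
at \<open>J\<close> is zero unless \<open>J\<close> belongs to \<open>S\<close>.\<close>

lemma bellman_drop_on_grid:
  assumes J: "J \<in> grid_level D (k + 1)"
  shows "(\<Sum>K\<in>grid_below D k J. 64 * kappa ^ 3 * C * (measure lebesgue K * cube_bellman K)) +
      (if J \<in> S then \<Sum>\<epsilon>\<in>Sig. (norm (A J \<epsilon> *v mean J f))\<^sup>2 else 0)
      \<le> 64 * kappa ^ 3 * C * (measure lebesgue J * cube_bellman J)"
proof -
  define m where "m = measure lebesgue J"
  define Ch where "Ch = grid_below D k J"
  define c where "c K = measure lebesgue K / m" for K :: "(real ^ 'd) set"
  define P where "P = (1 / (C * m)) *\<^sub>R (if J \<in> S then gram_sum J else 0)"
  have JD: "J \<in> D"
    by (rule grid_levelD[OF D J])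
  have m: "0 < m"
    unfolding m_def by (rule measure_pos[OF JD])
  have Ch: "finite Ch" "disjoint Ch" "\<Union> Ch = J"
    unfolding Ch_def using finite_grid_below[OF D J] grid_below_disjoint[OF D] grid_below_Union[OF D J] by auto
  have K: "K \<in> grid_level D k" "K \<in> D" if "K \<in> Ch" for K
    using that grid_levelD[OF D] by (auto simp: Ch_def grid_below_def)
  have Kpos: "0 < measure lebesgue K" if "K \<in> Ch" for K
    by (rule measure_pos[OF K(2)[OF that]])
  have int: "set_integrable lebesgue K W" "set_integrable lebesgue K V" "set_integrable lebesgue K f"
    "set_integrable lebesgue K energy" if "K \<in> Ch" for K
  proof -
    note level = K(1)[OF that]
    obtain a where a: "K = half_open_cube a (2 powi k)" "(0::real) < 2 powi k"
      by (rule grid_cube[OF level])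
    show "set_integrable lebesgue K W" "set_integrable lebesgue K V" "set_integrable lebesgue K f"
      "set_integrable lebesgue K energy"
      by (rule A2_integrals[OF a] f_set_integrable[OF a] energy_set_integrable[OF half_open_cube_positive(1)[OF a]])+
  qed
  have Kmeas: "K \<in> lmeasurable" if "K \<in> Ch" for K
    by (rule grid_level_measure(1)[OF D K(1)[OF that]])
  have mean_eq: "mean J g = (\<Sum>K\<in>Ch. c K *\<^sub>R mean K g)"
    if "\<And>K. K \<in> Ch \<Longrightarrow> set_integrable lebesgue K g"
    for g :: "real ^ 'd \<Rightarrow> 'b :: euclidean_space"
    using mean_finite_Union(1)[OF Ch _ Kmeas Kpos that] m by (simp add: c_def m_def)
  interpret bellman_step kappa Ch c "\<lambda>K. mean K W" "\<lambda>K. mean K V" packing "\<lambda>K. mean K energy"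
    "\<lambda>K. mean K f" "mean J W" "mean J V" "packing J" P "mean J energy" "mean J f"
  proof
    show "0 < kappa" by (rule kappa_pos)
    show "finite Ch" by (rule Ch)
    show "0 \<le> c K" if "K \<in> Ch" for K
      using m Kpos[OF that] by (simp add: c_def)
    show "(\<Sum>K\<in>Ch. c K) = 1"
      using mean_finite_Union(2)[OF Ch _ Kmeas Kpos int(1)] m by (simp add: c_def m_def)
    show "admissible kappa (mean J W) (mean J V) (packing J) (mean J energy) (mean J f)"
      by (rule admissible_grid[OF JD])
    show "admissible kappa (mean K W) (mean K V) (packing K) (mean K energy) (mean K f)" if "K \<in> Ch" for K
      by (rule admissible_grid[OF K(2)[OF that]])
    show "mean J W = (\<Sum>K\<in>Ch. c K *\<^sub>R mean K W)" "mean J V = (\<Sum>K\<in>Ch. c K *\<^sub>R mean K V)"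
      "mean J f = (\<Sum>K\<in>Ch. c K *\<^sub>R mean K f)"
      by (rule mean_eq, rule int, assumption)+
    show "mean J energy = (\<Sum>K\<in>Ch. c K * mean K energy)"
      using mean_eq[OF int(4)] by simp
    show "pos_semidef P"
      unfolding P_def using C m
      by (intro pos_semidef_intros(2)) (auto intro: pos_semidef_gram_sum pos_semidef_intros)
    have "(\<Sum>K\<in>Ch. c K *\<^sub>R packing K) = (\<Sum>K\<in>Ch. (1 / (C * m)) *\<^sub>R (\<Sum>I\<in>{I \<in> S. I \<subseteq> K}. gram_sum I))"
      using Kpos C by (intro sum.cong) (auto simp: packing_def c_def dest: less_imp_neq[THEN not_sym])
    then show "packing J = P + (\<Sum>K\<in>Ch. c K *\<^sub>R packing K)"
      unfolding packing_def[of J] sum_grid_below[OF D J S]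
      by (simp add: P_def Ch_def m_def scaleR_add_right scaleR_sum_right)
  qed
  have P_form: "(P *v mean J f) \<bullet> mean J f =
      (if J \<in> S then \<Sum>\<epsilon>\<in>Sig. (norm (A J \<epsilon> *v mean J f))\<^sup>2 else 0) / (C * m)"
    by (simp add: P_def matrix_vector_linear gram_sum_quadratic_form)
  have "(64 * kappa ^ 3 * C * m) * ((\<Sum>K\<in>Ch. c K * cube_bellman K) + (P *v mean J f) \<bullet> mean J f / (64 * kappa ^ 3))
      \<le> (64 * kappa ^ 3 * C * m) * cube_bellman J"
    using bellman_gain C m kappa_pos unfolding cube_bellman_def by (intro mult_left_mono) auto
  moreover have "(64 * kappa ^ 3 * C * m) * (\<Sum>K\<in>Ch. c K * cube_bellman K) =
      (\<Sum>K\<in>Ch. 64 * kappa ^ 3 * C * (measure lebesgue K * cube_bellman K))"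
    unfolding sum_distrib_left using m by (intro sum.cong) (auto simp: c_def)
  moreover have "(64 * kappa ^ 3 * C * m) * ((P *v mean J f) \<bullet> mean J f / (64 * kappa ^ 3)) =
      (if J \<in> S then \<Sum>\<epsilon>\<in>Sig. (norm (A J \<epsilon> *v mean J f))\<^sup>2 else 0)"
    unfolding P_form using C m kappa_pos by auto
  ultimately show ?thesis
    by (simp add: distrib_left Ch_def m_def)
qed

theorem finite_carleson_embedding:
  "(\<Sum>I\<in>S. \<Sum>\<epsilon>\<in>Sig. (norm (A I \<epsilon> *v mean I f))\<^sup>2) \<le> 64 * kappa ^ 3 * C * integral\<^sup>L lebesgue energy"
proof -
  define Z where "Z = 64 * kappa ^ 3 * C"
  have Z: "0 < Z"
    using kappa_pos C by (simp add: Z_def)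
  have B: "0 \<le> Z * (measure lebesgue J * cube_bellman J)" "cube_bellman J \<le> mean J energy" if "J \<in> D" for J
    using bellman_nonneg[OF admissible_grid[OF that] kappa_pos] bellman_le[OF admissible_grid[OF that] kappa_pos]
      Z measure_pos[OF that] by (auto simp: cube_bellman_def)
  obtain T where T: "finite T" "T \<subseteq> D" "disjoint T"
    and le: "(\<Sum>I\<in>S. \<Sum>\<epsilon>\<in>Sig. (norm (A I \<epsilon> *v mean I f))\<^sup>2) \<le> (\<Sum>J\<in>T. Z * (measure lebesgue J * cube_bellman J))"
    using grid_telescoping[OF D S B(1) bellman_drop_on_grid[folded Z_def]] by blast
  have meas: "J \<in> sets lebesgue" if "J \<in> T" for J
    using that T(2) grid_has_level[OF D] grid_level_measure(1)[OF D] by (meson fmeasurableD subsetD)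
  note le
  also have "(\<Sum>J\<in>T. Z * (measure lebesgue J * cube_bellman J)) \<le> (\<Sum>J\<in>T. Z * (LINT x:J|lebesgue. energy x))"
  proof (intro sum_mono mult_left_mono)
    fix J assume "J \<in> T"
    then have J: "J \<in> D" using T by auto
    have "measure lebesgue J * cube_bellman J \<le> measure lebesgue J * mean J energy"
      using B(2)[OF J] measure_pos[OF J] by simp
    then show "measure lebesgue J * cube_bellman J \<le> (LINT x:J|lebesgue. energy x)"
      using measure_pos[OF J] by (simp add: mean_def)
  qed (use Z in simp)
  also have "\<dots> = Z * (LINT x:(\<Union>J\<in>T. J)|lebesgue. energy x)"
  proof -
    have "disjoint_family_on (\<lambda>J. J) T"
      using T(3) unfolding disjoint_def disjoint_family_on_def by blast
    from set_integral_finite_Union[OF T(1) this energy_set_integrable[OF meas] meas]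
    show ?thesis by (simp add: sum_distrib_left)
  qed
  also have "\<dots> \<le> Z * integral\<^sup>L lebesgue energy"
  proof (rule mult_left_mono)
    have "(\<Union>J\<in>T. J) \<in> sets lebesgue"
      using T(1) meas by (intro sets.finite_UN) auto
    from energy_set_integrable[OF this]
    show "(LINT x:(\<Union>J\<in>T. J)|lebesgue. energy x) \<le> integral\<^sup>L lebesgue energy"
      unfolding set_lebesgue_integral_def set_integrable_def
      by (rule integral_mono_AE[OF _ energy_integrable])
         (use energy_nonneg in eventually_elim, auto simp: indicator_def)
  qed (use Z in simp)
  finally show ?thesis
    by (simp add: Z_def)
qed

end

lemma sum_infsum_ennreal:
  fixes g :: "'a \<Rightarrow> 'b \<Rightarrow> ennreal"
  assumes "finite X"
  shows "(\<Sum>x\<in>X. \<Sum>\<^sub>\<infinity>y\<in>Y. g x y) = (\<Sum>\<^sub>\<infinity>y\<in>Y. \<Sum>x\<in>X. g x y)"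
  using assms by (induction X rule: finite_induct) (simp_all add: infsum_add nonneg_summable_on_complete)

theorem corollary1p7:
  shows "\<exists>c>0. \<forall>(W :: real ^ 'd::finite \<Rightarrow> complex ^ 'n::finite ^ 'n) D A (C::real).
           A2_weight W \<longrightarrow> dyadic_grid D \<longrightarrow> C > 0 \<longrightarrow> matrix_carleson W D A C \<longrightarrow>
           (\<forall>f \<in> L2W W.
              (\<Sum>\<epsilon>\<in>Sig. \<Sum>\<^sub>\<infinity>I\<in>D. ennreal ((norm (A I \<epsilon> *v avg I f))\<^sup>2))
                \<le> ennreal (c * C) * A2_char W ^ 3 * L2W_norm_sq W f)"
proof (intro exI[of _ "64 * real CARD('n) ^ 3"] conjI allI impI ballI)
  fix W :: "real ^ 'd \<Rightarrow> complex ^ 'n ^ 'n" and D A and C :: real and f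
  assume A2: "A2_weight W" and D: "dyadic_grid D" and C: "C > 0" and carl: "matrix_carleson W D A C"
    and f: "f \<in> L2W W"
  interpret A2_weighted_function W f
    by unfold_locales (fact A2 f)+
  have "(\<Sum>\<epsilon>\<in>Sig. \<Sum>\<^sub>\<infinity>I\<in>D. ennreal ((norm (A I \<epsilon> *v avg I f))\<^sup>2))
      = (\<Sum>\<^sub>\<infinity>I\<in>D. \<Sum>\<epsilon>\<in>Sig. ennreal ((norm (A I \<epsilon> *v avg I f))\<^sup>2))"
    by (rule sum_infsum_ennreal[OF finite_Sig])
  also have "\<dots> \<le> ennreal (64 * (CARD('n) * q) ^ 3 * C * integral\<^sup>L lebesgue energy)"
  proof (rule infsum_le_finite_sums)
    fix S assume S: "finite S" "S \<subseteq> D"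
    interpret carleson_embedding W f D A C S
      by unfold_locales (fact D C carl S)+
    have "(\<Sum>I\<in>S. \<Sum>\<epsilon>\<in>Sig. ennreal ((norm (A I \<epsilon> *v avg I f))\<^sup>2))
        = ennreal (\<Sum>I\<in>S. \<Sum>\<epsilon>\<in>Sig. (norm (A I \<epsilon> *v mean I f))\<^sup>2)"
      by (simp add: avg_eq_mean sum_nonneg)
    also have "\<dots> \<le> ennreal (64 * (CARD('n) * q) ^ 3 * C * integral\<^sup>L lebesgue energy)"
      by (intro ennreal_leI finite_carleson_embedding)
    finally show "(\<Sum>I\<in>S. \<Sum>\<epsilon>\<in>Sig. ennreal ((norm (A I \<epsilon> *v avg I f))\<^sup>2))
        \<le> ennreal (64 * (CARD('n) * q) ^ 3 * C * integral\<^sup>L lebesgue energy)" .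
  qed (simp add: nonneg_summable_on_complete)
  also have "\<dots> = ennreal (64 * real CARD('n) ^ 3 * C) * A2_char W ^ 3 * L2W_norm_sq W f"
  proof -
    have "64 * (real CARD('n) * q) ^ 3 * C * integral\<^sup>L lebesgue energy
        = (64 * real CARD('n) ^ 3 * C) * q ^ 3 * integral\<^sup>L lebesgue energy"
      by (simp add: power_mult_distrib)
    then show ?thesis
      using C q(2) integral_nonneg_AE[OF energy_nonneg]
      by (simp only: q(1) energy_integral ennreal_power ennreal_mult mult_nonneg_nonneg zero_le_power
          less_imp_le of_nat_0_le_iff zero_le_numeral)
  qed
  finally show "(\<Sum>\<epsilon>\<in>Sig. \<Sum>\<^sub>\<infinity>I\<in>D. ennreal ((norm (A I \<epsilon> *v avg I f))\<^sup>2))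
      \<le> ennreal (64 * real CARD('n) ^ 3 * C) * A2_char W ^ 3 * L2W_norm_sq W f" .
qed simp

end
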